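(* Let $-1<\beta<0$. (a) Suppose that $\nu\geq\tfrac12$. Then, for all $x\geq0$, $$\frac{\mathrm{e}^{-\beta x}K_{\nu+2}(x)}{x^{\nu-1}}\int_0^x \mathrm{e}^{\beta t}t^{\nu}I_\nu(t)\,\mathrm{d}t<\frac{2(\nu+1)}{(2\nu+1)(1+\beta)}.$$ (b) Suppose now that $\nu>-\tfrac12$. Then $$\max\bigg\{\frac{1}{2(1+\beta)},\frac{2(\nu+1)}{2\nu+1}\bigg\}\leq\sup_{x\geq0}\bigg\{\frac{\mathrm{e}^{-\beta x}K_{\nu+2}(x)}{x^{\nu-1}}\int_0^x \mathrm{e}^{\beta t}t^{\nu}I_\nu(t)\,\mathrm{d}t\bigg\}<\frac{2\nu+7}{(2\nu+1)(1+\beta)},$$ and $$\frac{1}{2(1+\beta)}\leq\sup_{x\geq0}\bigg\{\frac{\mathrm{e}^{-\beta x}K_{\nu+1}(x)}{x^{\nu-1}}\int_0^x \mathrm{e}^{\beta t}t^{\nu}I_\nu(t)\,\mathrm{d}t\bigg\}<\frac{2\nu+7}{2(2\nu+1)(1+\beta)},$$ $$\frac{1}{2(1+\beta)}\leq\sup_{x\geq0}\bigg\{\frac{\mathrm{e}^{-\beta x}K_{\nu}(x)}{x^{\nu-1}}\int_0^x \mathrm{e}^{\beta t}t^{\nu}I_\nu(t)\,\mathrm{d}t\bigg\}<\frac{2\nu+7}{2(2\nu+1)(1+\beta)}.$$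
   Context: For $\nu\in\mathbb{R}$ and $x>0$, the modified Bessel functions of the first and second kind are $I_\nu(x)=\sum_{k=0}^\infty \frac{(x/2)^{\nu+2k}}{\Gamma(\nu+k+1)\,k!}$ and $K_\nu(x)=\int_0^\infty \mathrm{e}^{-x\cosh(t)}\cosh(\nu t)\,\mathrm{d}t$. At $x=0$ the expressions appearing in the claim are understood as their limits as $x\downarrow0$. *)

theory Defs
  imports "HOL-Analysis.Analysis"
begin

text \<open>
  The modified Bessel functions are meant for \<open>x > 0\<close>. In \<open>bessel_I\<close>, at a pole of the Gamma
  function the library has \<open>Gamma = 0\<close>, so the term is \<open>0\<close>, in line with the usual
  convention \<open>1 / Gamma = 0\<close>.
\<close>

definition bessel_I :: "real \<Rightarrow> real \<Rightarrow> real" where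
  "bessel_I \<nu> x =
     (\<Sum>k. (x / 2) powr (\<nu> + 2 * real k) / (Gamma (\<nu> + real k + 1) * fact k))"

definition bessel_K :: "real \<Rightarrow> real \<Rightarrow> real" where
  "bessel_K \<nu> x = integral {0..} (\<lambda>t. exp (- x * cosh t) * cosh (\<nu> * t))"

text \<open>A function on \<open>(0, \<infinity>)\<close>, extended to \<open>0\<close> by its limit from the right.\<close>

definition extend_0 :: "(real \<Rightarrow> real) \<Rightarrow> real \<Rightarrow> real" where
  "extend_0 f x = (if x = 0 then Lim (at_right 0) f else f x)"

text \<open>
  The order \<open>\<mu>\<close> of \<open>K\<close> is separate from the order \<open>\<nu>\<close> of \<open>I\<close>. For \<open>- 1 / 2 < \<nu> < 0\<close> the
  integrand is unbounded near \<open>0\<close>; the Henstock-Kurzweil integral covers this case.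
\<close>

definition KI_product :: "real \<Rightarrow> real \<Rightarrow> real \<Rightarrow> real \<Rightarrow> real" where
  "KI_product \<beta> \<nu> \<mu> = extend_0 (\<lambda>x. exp (- \<beta> * x) * bessel_K \<mu> x / x powr (\<nu> - 1) *
     integral {0..x} (\<lambda>t. exp (\<beta> * t) * t powr \<nu> * bessel_I \<nu> t))"

end

theory Submission
  imports Defs "HOL-Real_Asymp.Real_Asymp"
begin

text \<open>
  Write \<open>p = 2 * \<nu> + 1\<close>, \<open>\<delta> = 1 + \<beta>\<close> and let \<open>J x\<close> be the integral. To bound \<open>J\<close> by
  \<open>exp (\<beta> * x) * \<Phi> x\<close> it suffices to compare derivatives, i.e. to check
  \<open>x powr \<nu> * I \<nu> x \<le> \<Phi>' x + \<beta> * \<Phi> x\<close>. For \<open>\<nu> \<ge> 1 / 2\<close> the choice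
  \<open>\<Phi> x = (p + 1) / (p * \<delta>) * x powr \<nu> * I (\<nu> + 1) x\<close> works, by elementary bounds for
  \<open>I (\<nu> + 1) x / I \<nu> x\<close>. For \<open>\<bar>\<nu>\<bar> < 1 / 2\<close> that comparison fails at large \<open>x\<close>; there one uses
  \<open>\<Psi> x = x powr (\<nu> + 1) * (I \<nu> x + I (\<nu> + 1) x)\<close>, which satisfies
  \<open>\<Psi>' x = \<Psi> x + p * x powr \<nu> * I \<nu> x\<close>, and takes \<open>\<Phi> x = 2 / (p * (1 + \<delta> * x)) * \<Psi> x\<close>.
  What remains are the products \<open>x * I \<mu> x * K (\<mu> + 1) x < 1\<close>, from the Wronskian identity, and
  \<open>x * I (\<nu> + 1) x * K (\<nu> + 1) x < 1 / 2\<close>, from the Wronskian together with Turan type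
  inequalities for \<open>I\<close> and for \<open>K\<close>. In (b) the constants so obtained are smaller than those
  claimed, so the strict inequalities survive the supremum. The lower bounds are the limits of the
  product at \<open>0\<close> and at infinity.
\<close>

subsection \<open>The modified Bessel function of the first kind\<close>

definition bessel_coeff :: "real \<Rightarrow> nat \<Rightarrow> real" where
  "bessel_coeff \<nu> k = 1 / (Gamma (\<nu> + real k + 1) * fact k)"

text \<open>The Bessel-Clifford function: \<open>bessel_I \<nu> x\<close> is
  \<open>(x / 2) powr \<nu>\<close> times its value at \<open>y = x\<^sup>2 / 4\<close>. Once the
  real power is split off, a power series remains that can be differentiated termwise.\<close>

definition bessel_series :: "real \<Rightarrow> real \<Rightarrow> real" where
  "bessel_series \<nu> y = (\<Sum>k. bessel_coeff \<nu> k * y ^ k)"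

lemma bessel_coeff_pos: "\<nu> > -1 \<Longrightarrow> bessel_coeff \<nu> k > 0"
  unfolding bessel_coeff_def by (intro divide_pos_pos mult_pos_pos Gamma_real_pos) auto

lemma bessel_coeff_Suc:
  assumes "\<nu> > -1"
  shows "bessel_coeff \<nu> (Suc k) = bessel_coeff \<nu> k / ((\<nu> + real k + 1) * (real k + 1))"
proof -
  have "Gamma (\<nu> + real k + 1 + 1) = (\<nu> + real k + 1) * Gamma (\<nu> + real k + 1)"
    using assms by (intro Gamma_plus1) (auto simp: nonpos_Ints_def)
  then show ?thesis
    by (simp add: bessel_coeff_def algebra_simps)
qed

lemma bessel_coeff_shift:
  assumes "\<nu> > -1"
  shows "bessel_coeff (\<nu> + 1) k = real (Suc k) * bessel_coeff \<nu> (Suc k)"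
  by (simp add: bessel_coeff_def add_ac del: of_nat_Suc)
    (simp add: field_simps)

lemma summable_bessel_series:
  assumes "\<nu> > -1"
  shows "summable (\<lambda>k. bessel_coeff \<nu> k * y ^ k)"
proof -
  \<comment> \<open>From this \<open>N\<close> on,
    \<open>(\<nu> + real k + 1) * (real k + 1)\<close> is at least \<open>2 * \<bar>y\<bar>\<close>,
    so consecutive terms shrink by a factor of at least 2.\<close>
  obtain N :: nat where N: "real N \<ge> 2 * \<bar>y\<bar> / (\<nu> + 1)"
    using real_arch_simple by blast
  have "norm (bessel_coeff \<nu> (Suc k) * y ^ Suc k) \<le> 1/2 * norm (bessel_coeff \<nu> k * y ^ k)"
    if "k \<ge> N" for k
  proof -
    have pos: "(\<nu> + real k + 1) * (real k + 1) > 0" using assms by auto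
    have "2 * \<bar>y\<bar> \<le> (\<nu> + 1) * real N" using N assms by (simp add: field_simps)
    also have "\<dots> \<le> (\<nu> + real k + 1) * (real k + 1)"
      using assms that by (intro mult_mono) auto
    finally have "\<bar>y\<bar> / ((\<nu> + real k + 1) * (real k + 1)) \<le> 1/2"
      using pos by (simp add: field_simps)
    then have "\<bar>y\<bar> / ((\<nu> + real k + 1) * (real k + 1)) * \<bar>bessel_coeff \<nu> k * y ^ k\<bar>
        \<le> 1/2 * \<bar>bessel_coeff \<nu> k * y ^ k\<bar>"
      by (intro mult_right_mono) auto
    also have "\<bar>y\<bar> / ((\<nu> + real k + 1) * (real k + 1)) * \<bar>bessel_coeff \<nu> k * y ^ k\<bar>
        = \<bar>bessel_coeff \<nu> (Suc k) * y ^ Suc k\<bar>"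
      using pos assms by (simp add: bessel_coeff_Suc[OF assms] abs_mult)
    finally show ?thesis by simp
  qed
  then show ?thesis by (intro summable_ratio_test[of "1/2" N]) auto
qed

lemma bessel_series_0: "bessel_series \<nu> 0 = 1 / Gamma (\<nu> + 1)"
  using powser_zero[of "bessel_coeff \<nu>"] by (simp add: bessel_series_def bessel_coeff_def)

lemma bessel_series_pos:
  assumes "\<nu> > -1" "y \<ge> 0"
  shows "bessel_series \<nu> y > 0"
proof -
  have "bessel_coeff \<nu> k * y ^ k \<ge> 0" for k
    using assms bessel_coeff_pos[of \<nu> k] by (simp add: less_imp_le)
  moreover have "bessel_coeff \<nu> 0 * y ^ 0 > 0"
    using assms bessel_coeff_pos[of \<nu> 0] by simp
  ultimately show ?thesis
    unfolding bessel_series_def using summable_bessel_series[OF assms(1)] suminf_pos2 by blast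
qed

text \<open>Termwise differentiation turns the coefficients of order \<nu> into those of order \<nu>
  + 1, by \<open>bessel_coeff_shift\<close>.\<close>

lemma bessel_series_deriv:
  assumes "\<nu> > -1"
  shows "(bessel_series \<nu> has_real_derivative bessel_series (\<nu> + 1) y) (at y)"
proof -
  have "(bessel_series \<nu> has_real_derivative (\<Sum>k. diffs (bessel_coeff \<nu>) k * y ^ k)) (at y)"
    unfolding bessel_series_def
    by (rule termdiffs_strong[where K = "\<bar>y\<bar> + 1"]) (use summable_bessel_series[OF assms] in auto)
  also have "diffs (bessel_coeff \<nu>) = bessel_coeff (\<nu> + 1)"
    by (rule ext) (use bessel_coeff_shift[OF assms] in \<open>simp add: diffs_def\<close>)
  finally show ?thesis by (simp add: bessel_series_def[abs_def])
qed

text \<open>Comparison of coefficients: after an index shift the second summand contributes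
  \<open>k\<close> times the \<open>k\<close>-th coefficient of order \<nu> + 1, and
  \<open>\<nu> + 1 + k\<close> times that coefficient is the one of order \<nu>.\<close>

lemma bessel_series_rec:
  assumes "\<nu> > -1"
  shows "bessel_series \<nu> y = (\<nu> + 1) * bessel_series (\<nu> + 1) y + y * bessel_series (\<nu> + 2) y"
proof -
  have "(\<lambda>k. bessel_coeff (\<nu> + 1) k * y ^ k) sums bessel_series (\<nu> + 1) y"
       "(\<lambda>k. bessel_coeff (\<nu> + 2) k * y ^ k) sums bessel_series (\<nu> + 2) y"
    using summable_bessel_series assms by (auto simp: bessel_series_def intro!: summable_sums)
  moreover have "bessel_coeff (\<nu> + 2) k * y ^ k * y
      = real (Suc k) * (bessel_coeff (\<nu> + 1) (Suc k) * y ^ Suc k)" for k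
    using bessel_coeff_shift[of "\<nu> + 1" k] assms by (simp add: add.commute algebra_simps)
  ultimately have "(\<lambda>k. real (Suc k) * (bessel_coeff (\<nu> + 1) (Suc k) * y ^ Suc k))
      sums (bessel_series (\<nu> + 2) y * y)"
    using sums_mult2[of "\<lambda>k. bessel_coeff (\<nu> + 2) k * y ^ k" "bessel_series (\<nu> + 2) y" y]
    by presburger
  \<comment> \<open>The term at index 0 carries the factor 0, so undoing the shift leaves the sum
    unchanged.\<close>
  then have "(\<lambda>k. real k * (bessel_coeff (\<nu> + 1) k * y ^ k)) sums (bessel_series (\<nu> + 2) y * y)"
    by (subst (asm) sums_Suc_iff) simp
  moreover have "(\<lambda>k. (\<nu> + 1) * (bessel_coeff (\<nu> + 1) k * y ^ k))
      sums ((\<nu> + 1) * bessel_series (\<nu> + 1) y)"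
    using summable_bessel_series[of "\<nu> + 1"] assms
    by (auto simp: bessel_series_def intro!: sums_mult summable_sums)
  ultimately have "(\<lambda>k. (\<nu> + 1) * (bessel_coeff (\<nu> + 1) k * y ^ k)
        + real k * (bessel_coeff (\<nu> + 1) k * y ^ k))
      sums ((\<nu> + 1) * bessel_series (\<nu> + 1) y + bessel_series (\<nu> + 2) y * y)"
    by (intro sums_add)
  moreover have "(\<nu> + 1) * (bessel_coeff (\<nu> + 1) k * y ^ k)
      + real k * (bessel_coeff (\<nu> + 1) k * y ^ k) = bessel_coeff \<nu> k * y ^ k" for k
  proof -
    have "(\<nu> + real k + 1) * (real k + 1) \<noteq> 0" using assms by auto
    then have "bessel_coeff \<nu> k = (\<nu> + real k + 1) * (real k + 1) * bessel_coeff \<nu> (Suc k)"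
      using bessel_coeff_Suc[OF assms, of k] by (metis nonzero_mult_div_cancel_left times_divide_eq_right)
    then show ?thesis
      using bessel_coeff_shift[OF assms, of k] by (simp add: algebra_simps)
  qed
  ultimately show ?thesis
    unfolding bessel_series_def[of \<nu>] by (simp add: sums_iff mult.commute)
qed

section \<open>Recurrence and derivative of I\<close>

lemma bessel_I_eq:
  assumes "\<nu> > -1" "x > 0"
  shows "bessel_I \<nu> x = (x / 2) powr \<nu> * bessel_series \<nu> (x\<^sup>2 / 4)"
proof -
  have "(x / 2) powr (\<nu> + 2 * real k) / (Gamma (\<nu> + real k + 1) * fact k)
      = (x / 2) powr \<nu> * (bessel_coeff \<nu> k * (x\<^sup>2 / 4) ^ k)" for k
  proof -
    have "(x / 2) powr (2 * real k) = (x / 2) ^ (2 * k)"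
      using assms powr_realpow[of "x / 2" "2 * k"] by simp
    also have "\<dots> = (x\<^sup>2 / 4) ^ k" by (simp add: power_mult power_divide)
    finally show ?thesis by (simp add: powr_add bessel_coeff_def)
  qed
  then show ?thesis
    unfolding bessel_I_def bessel_series_def
    by (simp add: suminf_mult[OF summable_bessel_series[OF assms(1)]])
qed

lemma bessel_I_pos: "\<nu> > -1 \<Longrightarrow> x > 0 \<Longrightarrow> bessel_I \<nu> x > 0"
  by (simp add: bessel_I_eq bessel_series_pos)

lemma bessel_I_rec:
  assumes "\<nu> > -1" "x > 0"
  shows "bessel_I \<nu> x = bessel_I (\<nu> + 2) x + 2 * (\<nu> + 1) / x * bessel_I (\<nu> + 1) x"
proof -
  have "(x / 2) powr (\<nu> + 1) = (x / 2) powr \<nu> * (x / 2)"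
    "(x / 2) powr (\<nu> + 2) = (x / 2) powr \<nu> * (x / 2)\<^sup>2"
    using assms by (simp_all add: powr_add)
  with assms have "bessel_I (\<nu> + 2) x + 2 * (\<nu> + 1) / x * bessel_I (\<nu> + 1) x
      = (x / 2) powr \<nu> * ((\<nu> + 1) * bessel_series (\<nu> + 1) (x\<^sup>2 / 4)
        + x\<^sup>2 / 4 * bessel_series (\<nu> + 2) (x\<^sup>2 / 4))"
    by (simp only: bessel_I_eq) (simp add: bessel_I_eq field_simps power2_eq_square)
  then show ?thesis
    using assms bessel_series_rec[of \<nu> "x\<^sup>2 / 4"] by (simp add: bessel_I_eq)
qed

lemma powr_minus_times_bessel_I:
  assumes "\<nu> > -1" "x > 0"
  shows "x powr (-\<nu>) * bessel_I \<nu> x = 2 powr (-\<nu>) * bessel_series \<nu> (x\<^sup>2 / 4)"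
  using assms by (simp add: bessel_I_eq powr_divide powr_minus field_simps)

lemma bessel_I_deriv:
  assumes "\<nu> > -1" "x > 0"
  shows "(bessel_I \<nu> has_real_derivative bessel_I (\<nu> + 1) x + \<nu> / x * bessel_I \<nu> x) (at x)"
proof -
  have "((\<lambda>x. (x / 2) powr \<nu> * bessel_series \<nu> (x\<^sup>2 / 4)) has_real_derivative
      (x / 2) powr \<nu> * (bessel_series (\<nu> + 1) (x\<^sup>2 / 4) * (x / 2))
      + \<nu> * (x / 2) powr (\<nu> - 1) * (1 / 2) * bessel_series \<nu> (x\<^sup>2 / 4)) (at x)"
    using assms
    by (auto intro!: derivative_eq_intros DERIV_chain2[OF bessel_series_deriv[OF assms(1)]])
  also have "(x / 2) powr \<nu> * (bessel_series (\<nu> + 1) (x\<^sup>2 / 4) * (x / 2))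
      + \<nu> * (x / 2) powr (\<nu> - 1) * (1 / 2) * bessel_series \<nu> (x\<^sup>2 / 4)
      = bessel_I (\<nu> + 1) x + \<nu> / x * bessel_I \<nu> x"
    using assms by (simp add: bessel_I_eq powr_diff powr_add field_simps)
  finally show ?thesis
    by (rule has_field_derivative_transform_within_open[where S = "{0<..}"])
      (use assms in \<open>auto simp: bessel_I_eq\<close>)
qed

section \<open>Monotonicity from the right of 0, and inequalities for I obtained from it\<close>

lemma DERIV_nonneg_imp_nonneg_at_right_0:
  fixes f f' :: "real \<Rightarrow> real"
  assumes deriv: "\<And>x. x > 0 \<Longrightarrow> (f has_real_derivative f' x) (at x)"
    and nonneg: "\<And>x. x > 0 \<Longrightarrow> f' x \<ge> 0"
    and lim: "(f \<longlongrightarrow> 0) (at_right 0)" and "x > 0"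
  shows "f x \<ge> 0"
proof (rule tendsto_upperbound[OF lim])
  \<comment> \<open>As \<open>f\<close> is nondecreasing, \<open>f x\<close> bounds all earlier
    values and hence their limit 0.\<close>
  have "f y \<le> f x" if "0 < y" "y < x" for y
    by (rule DERIV_nonneg_imp_nondecreasing[where f = f])
      (use that in \<open>auto intro!: exI[of _ "f' _"] deriv nonneg\<close>)
  then show "\<forall>\<^sub>F y in at_right 0. f y \<le> f x"
    using \<open>x > 0\<close> by (auto simp: eventually_at_right_field)
qed simp

lemma DERIV_pos_imp_pos_at_right_0:
  fixes f f' :: "real \<Rightarrow> real"
  assumes deriv: "\<And>x. x > 0 \<Longrightarrow> (f has_real_derivative f' x) (at x)"
    and pos: "\<And>x. x > 0 \<Longrightarrow> f' x > 0"
    and lim: "(f \<longlongrightarrow> 0) (at_right 0)" and "x > 0"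
  shows "f x > 0"
proof -
  \<comment> \<open>The limit alone yields only nonnegativity; strictness comes from the increase
    between \<open>x / 2\<close> and \<open>x\<close>.\<close>
  have "f (x / 2) \<ge> 0"
    using DERIV_nonneg_imp_nonneg_at_right_0[OF deriv less_imp_le[OF pos] lim] \<open>x > 0\<close> by simp
  moreover have "f (x / 2) < f x"
    by (rule DERIV_pos_imp_increasing) (use \<open>x > 0\<close> in \<open>auto intro!: exI[of _ "f' _"] deriv pos\<close>)
  ultimately show ?thesis by simp
qed

text \<open>Together with \<open>bessel_I_deriv\<close> this is a closed first-order system for the
  orders \<nu> and \<nu> + 1, so that later derivatives never leave this pair.\<close>

lemma bessel_I_Suc_deriv:
  assumes "\<nu> > -1" "x > 0"
  shows "(bessel_I (\<nu> + 1) has_real_derivative bessel_I \<nu> x - (\<nu> + 1) / x * bessel_I (\<nu> + 1) x) (at x)"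
  using bessel_I_deriv[of "\<nu> + 1" x] assms bessel_I_rec[OF assms]
  by (simp add: add.assoc field_simps)

lemma powr_minus_bessel_I_tendsto:
  assumes "\<nu> > -1"
  shows "((\<lambda>x. x powr (-\<nu>) * bessel_I \<nu> x) \<longlongrightarrow> 2 powr (-\<nu>) / Gamma (\<nu> + 1)) (at_right 0)"
proof -
  have "isCont (bessel_series \<nu>) 0"
    using bessel_series_deriv[OF assms] DERIV_isCont by blast
  then have "((\<lambda>x. 2 powr (-\<nu>) * bessel_series \<nu> (x\<^sup>2 / 4)) \<longlongrightarrow> 2 powr (-\<nu>) * bessel_series \<nu> 0) (at_right 0)"
    by (intro tendsto_intros isCont_tendsto_compose[where g = "bessel_series \<nu>"]) (auto intro!: tendsto_eq_intros)
  then show ?thesis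
    by (rule Lim_transform_eventually[OF _ eventually_at_right_less[THEN eventually_mono], THEN tendsto_eq_rhs])
      (use assms in \<open>auto simp: powr_minus_times_bessel_I bessel_series_0\<close>)
qed

text \<open>Near 0 the function I behaves like a multiple of \<open>x powr \<nu>\<close>, so the
  total exponent \<open>a + \<nu>\<close> decides.\<close>

lemma powr_times_bessel_I_tendsto_0:
  assumes "\<nu> > -1" "a + \<nu> > 0"
  shows "((\<lambda>x. x powr a * bessel_I \<nu> x) \<longlongrightarrow> 0) (at_right 0)"
proof -
  have "((\<lambda>x. x powr (a + \<nu>)) \<longlongrightarrow> 0) (at_right 0)"
    using assms(2) by real_asymp
  from tendsto_mult[OF this powr_minus_bessel_I_tendsto[OF assms(1)]]
  have "((\<lambda>x. x powr (a + \<nu>) * (x powr (-\<nu>) * bessel_I \<nu> x)) \<longlongrightarrow> 0) (at_right 0)" by simp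
  then show ?thesis
    by (rule Lim_transform_eventually[OF _ eventually_at_right_less[THEN eventually_mono]])
      (auto simp: powr_add powr_minus field_simps)
qed

text \<open>With the integrating factor \<open>exp x * x powr (\<nu> + 1)\<close> the difference of
  the two sides has a derivative that collapses to a single positive term.\<close>

lemma bessel_I_ratio_lower:
  assumes "\<nu> > -1" "x > 0"
  shows "x * bessel_I \<nu> x < (2 * \<nu> + 2 + x) * bessel_I (\<nu> + 1) x"
proof -
  let ?f = "\<lambda>x. exp x * ((2 * \<nu> + 2 + x) * (x powr (\<nu> + 1) * bessel_I (\<nu> + 1) x) - x powr (\<nu> + 2) * bessel_I \<nu> x)"
  have "?f x > 0"
  proof (rule DERIV_pos_imp_pos_at_right_0[where f = ?f])
    fix x :: real assume x: "x > 0"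
    show "(?f has_real_derivative exp x * x powr (\<nu> + 1) * (2 * \<nu> + 3) * bessel_I (\<nu> + 1) x) (at x)"
      by (rule derivative_eq_intros bessel_I_deriv[OF assms(1) x] bessel_I_Suc_deriv[OF assms(1) x] x refl)+
        (use x in \<open>simp add: powr_add powr_diff field_simps power2_eq_square\<close>)
    show "exp x * x powr (\<nu> + 1) * (2 * \<nu> + 3) * bessel_I (\<nu> + 1) x > 0"
      using x assms bessel_I_pos[of "\<nu> + 1" x] by simp
  next
    have lim: "((\<lambda>x. x powr (\<nu> + 1) * bessel_I (\<nu> + 1) x) \<longlongrightarrow> 0) (at_right 0)"
      "((\<lambda>x. x powr (\<nu> + 2) * bessel_I \<nu> x) \<longlongrightarrow> 0) (at_right 0)"
      using assms by (auto intro!: powr_times_bessel_I_tendsto_0)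
    show "(?f \<longlongrightarrow> 0) (at_right 0)"
      by ((rule lim tendsto_eq_intros refl)+, simp)
  qed fact
  then have "0 < (2 * \<nu> + 2 + x) * (x powr (\<nu> + 1) * bessel_I (\<nu> + 1) x) - x powr (\<nu> + 2) * bessel_I \<nu> x"
    by (simp add: zero_less_mult_iff)
  also have "\<dots> = x powr (\<nu> + 1) * ((2 * \<nu> + 2 + x) * bessel_I (\<nu> + 1) x - x * bessel_I \<nu> x)"
    using assms by (simp add: powr_add algebra_simps power2_eq_square)
  finally show ?thesis by (simp add: zero_less_mult_iff)
qed

text \<open>Drops the positive term of order \<nu> + 2 from the recurrence.\<close>

lemma bessel_I_ratio_upper:
  assumes "\<nu> > -1" "x > 0"
  shows "(2 * \<nu> + 2) * bessel_I (\<nu> + 1) x < x * bessel_I \<nu> x"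
  using bessel_I_rec[OF assms] bessel_I_pos[of "\<nu> + 2" x] assms by (simp add: field_simps)

text \<open>The difference of the two sides vanishes at 0 and has derivative
  \<open>(2 * \<nu> + 1) / x\<close> times the product of the two functions, which is
  positive.\<close>

lemma bessel_I_turan:
  assumes "\<nu> > - 1 / 2" "x > 0"
  shows "(2 * \<nu> + 1) * bessel_I \<nu> x * bessel_I (\<nu> + 1) x < x * ((bessel_I \<nu> x)\<^sup>2 - (bessel_I (\<nu> + 1) x)\<^sup>2)"
proof -
  have nu: "\<nu> > -1" using assms by simp
  let ?f = "\<lambda>x. x * ((bessel_I \<nu> x)\<^sup>2 - (bessel_I (\<nu> + 1) x)\<^sup>2) - (2 * \<nu> + 1) * bessel_I \<nu> x * bessel_I (\<nu> + 1) x"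
  have "?f x > 0"
  proof (rule DERIV_pos_imp_pos_at_right_0[where f = ?f])
    fix x :: real assume x: "x > 0"
    show "(?f has_real_derivative (2 * \<nu> + 1) / x * bessel_I \<nu> x * bessel_I (\<nu> + 1) x) (at x)"
      by (rule derivative_eq_intros bessel_I_deriv[OF nu x] bessel_I_Suc_deriv[OF nu x] x refl)+
        (use x in \<open>simp add: field_simps power2_eq_square\<close>)
    show "(2 * \<nu> + 1) / x * bessel_I \<nu> x * bessel_I (\<nu> + 1) x > 0"
      using x assms bessel_I_pos[of "\<nu> + 1" x] bessel_I_pos[of "\<nu>" x] by simp
  next
    have lim: "((\<lambda>x. x powr (1/2) * bessel_I \<nu> x) \<longlongrightarrow> 0) (at_right 0)"
      "((\<lambda>x. x powr (1/2) * bessel_I (\<nu> + 1) x) \<longlongrightarrow> 0) (at_right 0)"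
      "((\<lambda>x. x powr (-1/2) * bessel_I (\<nu> + 1) x) \<longlongrightarrow> 0) (at_right 0)"
      using assms by (auto intro!: powr_times_bessel_I_tendsto_0)
    \<comment> \<open>The factor \<open>x\<close> is shared out as square roots: for negative \<nu>
      the function of order \<nu> is unbounded at 0, but \<nu> > -1/2 makes each of the weighted
      factors tend to 0.\<close>
    have "((\<lambda>x. (x powr (1/2) * bessel_I \<nu> x)\<^sup>2 - (x powr (1/2) * bessel_I (\<nu> + 1) x)\<^sup>2
        - (2 * \<nu> + 1) * (x powr (1/2) * bessel_I \<nu> x) * (x powr (-1/2) * bessel_I (\<nu> + 1) x)) \<longlongrightarrow> 0) (at_right 0)"
      by ((rule lim tendsto_eq_intros refl)+, simp)
    then show "(?f \<longlongrightarrow> 0) (at_right 0)"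
      by (rule Lim_transform_eventually[OF _ eventually_at_right_less[THEN eventually_mono]])
        (simp add: power_mult_distrib powr_half_sqrt powr_minus_divide right_diff_distrib)
  qed fact
  then show ?thesis by simp
qed

lemma bessel_I_Suc_less:
  assumes "\<nu> > - 1 / 2" "x > 0"
  shows "bessel_I (\<nu> + 1) x < bessel_I \<nu> x"
proof -
  have pos: "bessel_I (\<nu> + 1) x > 0" "bessel_I \<nu> x > 0" using assms by (auto intro: bessel_I_pos)
  then have "0 < (2 * \<nu> + 1) * bessel_I \<nu> x * bessel_I (\<nu> + 1) x" using assms by simp
  with bessel_I_turan[OF assms] assms(2) have "(bessel_I (\<nu> + 1) x)\<^sup>2 < (bessel_I \<nu> x)\<^sup>2"
    by (smt (verit) zero_less_mult_iff)
  with pos show ?thesis by (simp add: power2_less_imp_less)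
qed

text \<open>Weighted by \<open>exp x * x powr (- \<nu>)\<close>, the difference has a derivative
  with the factor \<open>2 * \<nu> - 1 + (2 * \<nu> + 1) / x\<close>. Its sign for all positive
  \<open>x\<close> is what \<nu> \<ge> 1/2 secures.\<close>

lemma bessel_I_Suc_le:
  assumes "\<nu> \<ge> 1 / 2" "x > 0"
  shows "(x + 1) * bessel_I (\<nu> + 1) x \<le> x * bessel_I \<nu> x"
proof -
  have nu: "\<nu> > -1" using assms by simp
  let ?f = "\<lambda>x. exp x * (x powr (1 - \<nu>) * bessel_I \<nu> x - (x + 1) * (x powr (- \<nu>) * bessel_I (\<nu> + 1) x))"
  let ?f' = "\<lambda>x. exp x * x powr (-\<nu>) * bessel_I (\<nu> + 1) x * (2 * \<nu> - 1 + (2 * \<nu> + 1) / x)"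
  have "?f x \<ge> 0"
  proof (rule DERIV_nonneg_imp_nonneg_at_right_0[where f = ?f])
    fix x :: real assume x: "x > 0"
    show "(?f has_real_derivative ?f' x) (at x)"
      by (rule derivative_eq_intros bessel_I_deriv[OF nu x] bessel_I_Suc_deriv[OF nu x] x refl)+
        (use x in \<open>simp add: powr_add powr_diff powr_minus field_simps power2_eq_square\<close>)
    show "?f' x \<ge> 0"
      using x assms bessel_I_pos[of "\<nu> + 1" x] by (intro mult_nonneg_nonneg add_nonneg_nonneg) auto
  next
    have lim: "((\<lambda>x. x powr (1 - \<nu>) * bessel_I \<nu> x) \<longlongrightarrow> 0) (at_right 0)"
      "((\<lambda>x. x powr (- \<nu>) * bessel_I (\<nu> + 1) x) \<longlongrightarrow> 0) (at_right 0)"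
      using assms by (auto intro!: powr_times_bessel_I_tendsto_0)
    show "(?f \<longlongrightarrow> 0) (at_right 0)"
      by ((rule lim tendsto_eq_intros refl)+, simp)
  qed fact
  then have "0 \<le> x powr (1 - \<nu>) * bessel_I \<nu> x - (x + 1) * (x powr (- \<nu>) * bessel_I (\<nu> + 1) x)"
    by (simp add: zero_le_mult_iff)
  also have "\<dots> = x powr (-\<nu>) * (x * bessel_I \<nu> x - (x + 1) * bessel_I (\<nu> + 1) x)"
    using assms by (simp add: powr_diff powr_minus field_simps)
  finally show ?thesis using assms by (simp add: zero_le_mult_iff)
qed

subsection \<open>The modified Bessel function of the second kind\<close>

text \<open>Since \<open>cosh t\<close> is at least \<open>t\<^sup>2 / 4\<close>, the kernel decays
  like a Gaussian and absorbs any exponential, with a decay \<open>exp (- t)\<close> left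
  over.\<close>

lemma exp_minus_cosh_bound:
  fixes m x t :: real
  assumes "x > 0" "t \<ge> 0"
  shows "exp (- x * cosh t) * exp (m * t) \<le> exp ((m + 1)\<^sup>2 / x) * exp (- t)"
proof -
  have "t\<^sup>2 / 4 \<le> exp t / 2" using exp_lower_Taylor_quadratic[OF assms(2)] assms(2) by simp
  also have "\<dots> \<le> cosh t" by (simp add: cosh_def)
  finally have "x * (t\<^sup>2 / 4) \<le> x * cosh t" using assms by (intro mult_left_mono) auto
  moreover have "(m + 1) * t \<le> (m + 1)\<^sup>2 / x + x * (t\<^sup>2 / 4)"
  proof -
    \<comment> \<open>Completing the square: \<open>(m + 1)\<^sup>2 / x\<close> is the maximum of
      \<open>(m + 1) * t - x * t\<^sup>2 / 4\<close> over \<open>t\<close>.\<close>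
    have "0 \<le> (x * t / 2 - (m + 1))\<^sup>2 / x" using assms by simp
    also have "\<dots> = (m + 1)\<^sup>2 / x + x * (t\<^sup>2 / 4) - (m + 1) * t"
      using assms by (simp add: field_simps power2_eq_square)
    finally show ?thesis by simp
  qed
  ultimately have "- x * cosh t + m * t \<le> (m + 1)\<^sup>2 / x - t" by (simp add: algebra_simps)
  then show ?thesis by (simp flip: exp_add)
qed

lemma exp_cosh_integrable:
  fixes g :: "real \<Rightarrow> real"
  assumes "x > 0" and cont: "continuous_on {0..} g"
    and bound: "\<And>t. t \<ge> 0 \<Longrightarrow> \<bar>g t\<bar> \<le> C * exp (m * t)"
  shows "(\<lambda>t. exp (- x * cosh t) * g t) integrable_on {0..}"
proof (rule measurable_bounded_by_integrable_imp_integrable)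
  show "(\<lambda>t. exp (- x * cosh t) * g t) \<in> borel_measurable (lebesgue_on {0..})"
    by (intro continuous_imp_measurable_on_sets_lebesgue continuous_intros cont) auto
  show "(\<lambda>t. C * (exp ((m + 1)\<^sup>2 / x) * exp (- 1 * t))) integrable_on {0..}"
    by (intro integrable_on_mult_right integrable_on_exp_minus_to_infinity) auto
  fix t :: real assume "t \<in> {0..}"
  then have t: "t \<ge> 0" by simp
  have "C \<ge> 0" using bound[of 0] by auto
  have "norm (exp (- x * cosh t) * g t) \<le> exp (- x * cosh t) * (C * exp (m * t))"
    using bound[OF t] by (simp add: abs_mult)
  also have "\<dots> \<le> C * (exp ((m + 1)\<^sup>2 / x) * exp (- 1 * t))"
    using mult_left_mono[OF exp_minus_cosh_bound[OF assms(1) t, of m] \<open>C \<ge> 0\<close>] by (simp add: mult_ac)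
  finally show "norm (exp (- x * cosh t) * g t) \<le> C * (exp ((m + 1)\<^sup>2 / x) * exp (- 1 * t))" .
qed simp

lemma cosh_times_le_exp: "\<bar>cosh (\<mu> * t)\<bar> \<le> 1 * exp (\<bar>\<mu>\<bar> * t)" if "t \<ge> 0" for \<mu> t :: real
proof -
  have "\<bar>\<mu> * t\<bar> = \<bar>\<mu>\<bar> * t" using that by (simp add: abs_mult)
  then have "exp (\<mu> * t) \<le> exp (\<bar>\<mu>\<bar> * t)" "exp (- (\<mu> * t)) \<le> exp (\<bar>\<mu>\<bar> * t)"
    by (metis abs_ge_self exp_le_cancel_iff, metis abs_ge_minus_self exp_le_cancel_iff)
  then have "exp (\<mu> * t) + exp (- (\<mu> * t)) \<le> exp (\<bar>\<mu>\<bar> * t) + exp (\<bar>\<mu>\<bar> * t)"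
    by (rule add_mono)
  then show ?thesis by (simp add: cosh_def del: exp_le_cancel_iff)
qed

lemma bessel_K_integrable:
  fixes x \<mu> :: real
  assumes "x > 0"
  shows "(\<lambda>t. exp (- x * cosh t) * cosh (\<mu> * t)) integrable_on {0..}"
  by (rule exp_cosh_integrable[OF assms, where C = 1 and m = "\<bar>\<mu>\<bar>"]) (use cosh_times_le_exp in \<open>auto intro!: continuous_intros\<close>)

lemma integral_Ici_pos:
  fixes f :: "real \<Rightarrow> real"
  assumes "f integrable_on {a..}" "continuous_on {a..} f" "\<And>t. t \<ge> a \<Longrightarrow> f t > 0"
  shows "integral {a..} f > 0"
proof -
  have int: "f integrable_on {a..a+1}"
    by (rule integrable_continuous_real) (rule continuous_on_subset[OF assms(2)], auto)
  have "0 < integral {a..a+1} f"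
    using integral_less_real[of a "a+1" "\<lambda>_. 0" f] assms continuous_on_subset[OF assms(2), of "{a..a+1}"]
    by auto
  also have "\<dots> \<le> integral {a..} f"
    by (rule integral_subset_le) (use assms int in \<open>auto intro: less_imp_le\<close>)
  finally show ?thesis .
qed

lemma bessel_K_pos: "x > 0 \<Longrightarrow> bessel_K \<mu> x > 0"
  unfolding bessel_K_def
  by (rule integral_Ici_pos) (rule bessel_K_integrable continuous_intros mult_pos_pos | simp)+

lemma bessel_K_le:
  assumes "x > 0" "\<bar>\<mu>\<bar> \<le> \<bar>\<mu>'\<bar>"
  shows "bessel_K \<mu> x \<le> bessel_K \<mu>' x"
  unfolding bessel_K_def
proof (intro integral_le bessel_K_integrable assms mult_left_mono)
  fix t :: real assume "t \<in> {0..}"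
  then have "\<bar>\<mu> * t\<bar> \<le> \<bar>\<mu>' * t\<bar>" using assms by (auto simp: abs_mult intro: mult_right_mono)
  then show "cosh (\<mu> * t) \<le> cosh (\<mu>' * t)"
    by (metis abs_ge_zero cosh_real_abs cosh_real_nonneg_le_iff)
qed auto

text \<open>As \<open>cosh t \<ge> 1\<close>, the exponent satisfies
  \<open>x * cosh t \<ge> (x - 1) + cosh t\<close>, which pulls \<open>exp (1 - x)\<close> out of
  the integral.\<close>

lemma bessel_K_exp_decay:
  assumes "x \<ge> 1"
  shows "bessel_K \<mu> x \<le> exp (1 - x) * bessel_K \<mu> 1"
proof -
  have "bessel_K \<mu> x \<le> integral {0..} (\<lambda>t. exp (1 - x) * (exp (- 1 * cosh t) * cosh (\<mu> * t)))"
    unfolding bessel_K_def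
  proof (intro integral_le bessel_K_integrable integrable_on_mult_right)
    fix t :: real
    have "(x - 1) * 1 \<le> (x - 1) * cosh t" using assms by (intro mult_left_mono) (auto simp: cosh_real_ge_1)
    then have "exp (- x * cosh t) \<le> exp (1 - x) * exp (- 1 * cosh t)"
      by (simp add: algebra_simps flip: exp_add)
    then show "exp (- x * cosh t) * cosh (\<mu> * t) \<le> exp (1 - x) * (exp (- 1 * cosh t) * cosh (\<mu> * t))"
      by (simp add: mult.assoc[symmetric] mult_right_mono)
  qed (use assms in auto)
  then show ?thesis by (simp add: bessel_K_def)
qed

text \<open>The integral over an unbounded set is approximated on all large boxes; a box reaching
  far enough to the left meets the half-line in \<open>{a..y}\<close>.\<close>

lemma tendsto_integral_Ici:
  fixes f :: "real \<Rightarrow> real"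
  assumes "f integrable_on {a..}"
  shows "((\<lambda>y. integral {a..y} f) \<longlongrightarrow> integral {a..} f) at_top"
proof (rule tendstoI)
  fix e :: real assume "e > 0"
  have "(f has_integral integral {a..} f) {a..}" using assms by (rule integrable_integral)
  then obtain B where "B > 0" and B: "\<And>c d. ball 0 B \<subseteq> cbox c d \<Longrightarrow>
      norm (integral (cbox c d) (\<lambda>x. if x \<in> {a..} then f x else 0) - integral {a..} f) < e"
    using \<open>e > 0\<close> by (subst (asm) has_integral_alt') blast
  have "dist (integral {a..y} f) (integral {a..} f) < e" if "y \<ge> B + \<bar>a\<bar>" for y
  proof -
    have "ball 0 B \<subseteq> cbox (- (B + \<bar>a\<bar>)) y" using that by (auto simp: dist_real_def)
    moreover have "{a..} \<inter> cbox (- (B + \<bar>a\<bar>)) y = {a..y}" using \<open>B > 0\<close> by auto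
    ultimately show ?thesis using B by (metis dist_norm integral_restrict_Int)
  qed
  then show "\<forall>\<^sub>F y in at_top. dist (integral {a..y} f) (integral {a..} f) < e"
    using eventually_ge_at_top by (rule eventually_mono[rotated])
qed

text \<open>Integration by parts in disguise: the combination \<open>h\<close> of integrands is the
  derivative of \<open>F\<close>, which vanishes at 0 and at infinity, so \<open>h\<close> has
  integral 0.\<close>

lemma bessel_K_rec:
  assumes "x > 0"
  shows "bessel_K (\<mu> + 1) x = bessel_K (\<mu> - 1) x + 2 * \<mu> / x * bessel_K \<mu> x"
proof -
  define E where "E \<mu> t = exp (- x * cosh t) * cosh (\<mu> * t)" for \<mu> t
  define F where "F t = 2 * exp (- x * cosh t) * sinh (\<mu> * t)" for t
  define h where "h t = 2 * \<mu> * E \<mu> t - x * (E (\<mu> + 1) t - E (\<mu> - 1) t)" for t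
  have int: "E m integrable_on {0..}" for m
    unfolding E_def using bessel_K_integrable[OF assms] .
  have "(F has_real_derivative h t) (at t)" for t
  proof -
    have "E (\<mu> + 1) t - E (\<mu> - 1) t = 2 * exp (- x * cosh t) * sinh (\<mu> * t) * sinh t"
      by (simp add: E_def distrib_right left_diff_distrib cosh_add cosh_diff right_diff_distrib)
        (simp add: algebra_simps)
    then show ?thesis
      unfolding F_def h_def
      by (auto intro!: derivative_eq_intros simp: E_def algebra_simps)
  qed
  then have FTC: "(h has_integral F y - F 0) {0..y}" if "y \<ge> 0" for y
    using that by (intro fundamental_theorem_of_calculus)
      (auto simp flip: has_real_derivative_iff_has_vector_derivative intro: has_field_derivative_at_within)
  have inth: "h integrable_on {0..}"
    unfolding h_def by (intro integrable_diff integrable_on_mult_right int)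
  have "((\<lambda>y. integral {0..y} h) \<longlongrightarrow> integral {0..} h) at_top"
    by (rule tendsto_integral_Ici[OF inth])
  moreover have "((\<lambda>y. integral {0..y} h) \<longlongrightarrow> 0) at_top"
  proof (rule Lim_null_comparison)
    show "\<forall>\<^sub>F y in at_top. norm (integral {0..y} h) \<le> 2 * (exp ((\<bar>\<mu>\<bar> + 1)\<^sup>2 / x) * exp (- y))"
    proof (rule eventually_mono[OF eventually_ge_at_top])
      fix y :: real assume y: "0 \<le> y"
      have "\<bar>sinh (\<mu> * y)\<bar> \<le> cosh (\<mu> * y)"
        using cosh_real_pos[of "\<mu> * y"] sinh_le_cosh_real[of "\<mu> * y"] sinh_le_cosh_real[of "- (\<mu> * y)"] by simp
      also have "\<dots> \<le> exp (\<bar>\<mu>\<bar> * y)" using cosh_times_le_exp[OF y, of \<mu>] by simp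
      finally have "exp (- x * cosh y) * \<bar>sinh (\<mu> * y)\<bar> \<le> exp (- x * cosh y) * exp (\<bar>\<mu>\<bar> * y)"
        by (rule mult_left_mono) simp
      also have "\<dots> \<le> exp ((\<bar>\<mu>\<bar> + 1)\<^sup>2 / x) * exp (- y)"
        by (rule exp_minus_cosh_bound[OF assms y])
      finally have "\<bar>F y\<bar> \<le> 2 * (exp ((\<bar>\<mu>\<bar> + 1)\<^sup>2 / x) * exp (- y))"
        by (simp add: F_def abs_mult)
      moreover have "integral {0..y} h = F y"
        using integral_unique[OF FTC[OF y]] by (simp add: F_def)
      ultimately show "norm (integral {0..y} h) \<le> 2 * (exp ((\<bar>\<mu>\<bar> + 1)\<^sup>2 / x) * exp (- y))"
        by simp
    qed
    show "((\<lambda>y. 2 * (exp ((\<bar>\<mu>\<bar> + 1)\<^sup>2 / x) * exp (- y))) \<longlongrightarrow> 0) at_top"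
      by (intro tendsto_mult_right_zero) real_asymp
  qed
  ultimately have "integral {0..} h = 0"
    using tendsto_unique trivial_limit_at_top_linorder by blast
  moreover have "integral {0..} h = 2 * \<mu> * bessel_K \<mu> x - x * (bessel_K (\<mu> + 1) x - bessel_K (\<mu> - 1) x)"
  proof -
    have K: "bessel_K m x = integral {0..} (E m)" for m
      by (simp add: bessel_K_def E_def[abs_def])
    show ?thesis
      unfolding h_def K by (simp add: integral_diff integrable_diff integrable_on_mult_right int)
  qed
  ultimately show ?thesis using assms by (simp add: field_simps)
qed

lemma exp_second_order_bound: "\<bar>exp y - 1 - y\<bar> \<le> y\<^sup>2 * exp \<bar>y\<bar> / 2" for y :: real
proof -
  obtain t where t: "\<bar>t\<bar> \<le> \<bar>y\<bar>" and "exp y = (\<Sum>m<2. y ^ m / fact m) + exp t / fact 2 * y ^ 2"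
    using Maclaurin_exp_le[of y 2] by blast
  then have "exp y - 1 - y = y\<^sup>2 * exp t / 2" by (simp add: numeral_2_eq_2)
  then have "\<bar>exp y - 1 - y\<bar> = y\<^sup>2 * exp t / 2" by (metis abs_of_nonneg divide_nonneg_nonneg
      exp_ge_zero mult_nonneg_nonneg zero_le_numeral zero_le_power2)
  moreover have "y\<^sup>2 * exp t \<le> y\<^sup>2 * exp \<bar>y\<bar>" using t by (intro mult_left_mono) auto
  ultimately show ?thesis by simp
qed

text \<open>Differentiation under the integral sign, with an explicit remainder
  \<open>h\<^sup>2 * N\<close> from the second-order Taylor bound for the exponential. The resulting
  integral \<open>- M\<close> is then expressed through neighbouring orders.\<close>

lemma bessel_K_deriv:
  assumes "x > 0"
  shows "(bessel_K \<mu> has_real_derivative \<mu> / x * bessel_K \<mu> x - bessel_K (\<mu> + 1) x) (at x)"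
proof -
  define M where "M = integral {0..} (\<lambda>t. exp (- x * cosh t) * (cosh t * cosh (\<mu> * t)))"
  \<comment> \<open>For \<open>\<bar>h\<bar> \<le> x / 2\<close> the factor
    \<open>exp (\<bar>h\<bar> * cosh t)\<close> of the remainder uses up at most half of the decay
    \<open>exp (- x * cosh t)\<close>, whence \<open>x / 2\<close> here.\<close>
  define N where "N = integral {0..} (\<lambda>t. exp (- (x / 2) * cosh t) * ((cosh t)\<^sup>2 * cosh (\<mu> * t)))"
  have bound: "\<bar>(cosh t) ^ n * cosh (\<mu> * t)\<bar> \<le> 1 * exp ((real n + \<bar>\<mu>\<bar>) * t)" if "t \<ge> 0" for t :: real and n
  proof -
    have "\<bar>(cosh t) ^ n * cosh (\<mu> * t)\<bar> = \<bar>cosh (1 * t)\<bar> ^ n * \<bar>cosh (\<mu> * t)\<bar>" by (simp add: abs_mult)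
    also have "\<dots> \<le> (exp t) ^ n * exp (\<bar>\<mu>\<bar> * t)"
      using cosh_times_le_exp[OF that, of 1] cosh_times_le_exp[OF that, of \<mu>]
      by (intro mult_mono power_mono) auto
    also have "\<dots> = 1 * exp ((real n + \<bar>\<mu>\<bar>) * t)"
      by (simp add: exp_add distrib_right flip: exp_of_nat_mult)
    finally show ?thesis .
  qed
  have intM: "(\<lambda>t. exp (- x * cosh t) * (cosh t * cosh (\<mu> * t))) integrable_on {0..}"
    using bound[of _ 1] by (intro exp_cosh_integrable[OF assms, where C = 1]) (auto intro!: continuous_intros)
  have intN: "(\<lambda>t. exp (- (x / 2) * cosh t) * ((cosh t)\<^sup>2 * cosh (\<mu> * t))) integrable_on {0..}"
    using assms by (intro exp_cosh_integrable[OF _ _ bound]) (auto intro!: continuous_intros)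
  have quad: "\<bar>bessel_K \<mu> (x + h) - bessel_K \<mu> x + h * M\<bar> \<le> h\<^sup>2 * N" if h: "\<bar>h\<bar> \<le> x / 2" for h
  proof -
    have "x + h > 0" using h assms by linarith
    note int = bessel_K_integrable[OF this, of \<mu>] bessel_K_integrable[OF assms, of \<mu>]
    let ?d = "\<lambda>t. exp (- (x + h) * cosh t) * cosh (\<mu> * t) - exp (- x * cosh t) * cosh (\<mu> * t)
        + h * (exp (- x * cosh t) * (cosh t * cosh (\<mu> * t)))"
    have "bessel_K \<mu> (x + h) - bessel_K \<mu> x + h * M = integral {0..} ?d"
      unfolding bessel_K_def M_def
      by (subst integral_add integral_diff integral_mult_right
          | intro int intM integrable_diff integrable_on_mult_right refl)+
    moreover have "norm (integral {0..} ?d)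
        \<le> integral {0..} (\<lambda>t. h\<^sup>2 * (exp (- (x / 2) * cosh t) * ((cosh t)\<^sup>2 * cosh (\<mu> * t))))"
    proof (intro integral_norm_bound_integral integrable_on_mult_right intN
        integrable_add integrable_diff int intM)
      fix t :: real
      let ?c = "cosh t"
      have "\<bar>exp (- h * ?c) - 1 - (- h * ?c)\<bar> \<le> (- h * ?c)\<^sup>2 * exp \<bar>- h * ?c\<bar> / 2"
        by (rule exp_second_order_bound)
      also have "\<dots> \<le> (h * ?c)\<^sup>2 * exp (x / 2 * ?c)"
      proof -
        have "\<bar>h\<bar> * ?c \<le> x / 2 * ?c" using h by (intro mult_right_mono) auto
        then have "exp \<bar>- h * ?c\<bar> \<le> exp (x / 2 * ?c)" by (simp add: abs_mult)
        then have "(h * ?c)\<^sup>2 * exp \<bar>- h * ?c\<bar> \<le> (h * ?c)\<^sup>2 * exp (x / 2 * ?c)"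
          by (intro mult_left_mono) auto
        moreover have "0 \<le> (h * ?c)\<^sup>2 * exp \<bar>- h * ?c\<bar>" by simp
        moreover have "(- h * ?c)\<^sup>2 = (h * ?c)\<^sup>2" by simp
        ultimately show ?thesis by (simp only:)
      qed
      finally have "exp (- x * ?c) * cosh (\<mu> * t) * \<bar>exp (- h * ?c) - 1 - (- h * ?c)\<bar>
          \<le> exp (- x * ?c) * cosh (\<mu> * t) * ((h * ?c)\<^sup>2 * exp (x / 2 * ?c))"
        by (intro mult_left_mono) auto
      also have "\<dots> = h\<^sup>2 * (exp (- x * ?c) * exp (x / 2 * ?c) * (?c\<^sup>2 * cosh (\<mu> * t)))"
        by (simp add: power_mult_distrib)
      also have "exp (- x * ?c) * exp (x / 2 * ?c) = exp (- (x / 2) * ?c)"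
        by (simp flip: exp_add)
      also have "exp (- x * ?c) * cosh (\<mu> * t) * \<bar>exp (- h * ?c) - 1 - (- h * ?c)\<bar>
          = \<bar>exp (- x * ?c) * cosh (\<mu> * t) * (exp (- h * ?c) - 1 - (- h * ?c))\<bar>"
        by (simp add: abs_mult)
      also have "exp (- x * ?c) * cosh (\<mu> * t) * (exp (- h * ?c) - 1 - (- h * ?c)) = ?d t"
      proof -
        have "exp (- (x + h) * ?c) = exp (- x * ?c) * exp (- h * ?c)"
          by (simp add: algebra_simps flip: exp_add)
        then show ?thesis by (simp only:) (simp add: algebra_simps)
      qed
      finally show "norm (?d t) \<le> h\<^sup>2 * (exp (- (x / 2) * ?c) * (?c\<^sup>2 * cosh (\<mu> * t)))"
        by simp
    qed
    ultimately show ?thesis by (simp add: N_def)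
  qed
  have "((\<lambda>h. (bessel_K \<mu> (x + h) - bessel_K \<mu> x) / h - (- M)) \<longlongrightarrow> 0) (at 0)"
  proof (rule Lim_null_comparison)
    have "\<forall>\<^sub>F h in at 0. h \<noteq> 0 \<and> \<bar>h\<bar> < x / 2"
      unfolding eventually_at using assms by (intro exI[of _ "x / 2"]) auto
    then show "\<forall>\<^sub>F h in at 0. norm ((bessel_K \<mu> (x + h) - bessel_K \<mu> x) / h - (- M)) \<le> \<bar>h\<bar> * N"
    proof (rule eventually_mono)
      fix h assume h: "h \<noteq> 0 \<and> \<bar>h\<bar> < x / 2"
      have "(bessel_K \<mu> (x + h) - bessel_K \<mu> x) / h - (- M) = (bessel_K \<mu> (x + h) - bessel_K \<mu> x + h * M) / h"
        using h by (simp add: field_simps)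
      then have "norm ((bessel_K \<mu> (x + h) - bessel_K \<mu> x) / h - (- M))
          = \<bar>bessel_K \<mu> (x + h) - bessel_K \<mu> x + h * M\<bar> / \<bar>h\<bar>" by simp
      also have "\<dots> \<le> (h\<^sup>2 * N) / \<bar>h\<bar>" using quad[of h] h by (intro divide_right_mono) auto
      also have "\<dots> = \<bar>h\<bar> * N" using h by (simp add: field_simps power2_eq_square)
      finally show "norm ((bessel_K \<mu> (x + h) - bessel_K \<mu> x) / h - (- M)) \<le> \<bar>h\<bar> * N" .
    qed
    show "((\<lambda>h. \<bar>h\<bar> * N) \<longlongrightarrow> 0) (at 0)" by (auto intro!: tendsto_eq_intros)
  qed
  then have "(bessel_K \<mu> has_real_derivative - M) (at x)"
    unfolding DERIV_def by (subst Lim_null)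
  \<comment> \<open>Product-to-sum formula for \<open>2 * cosh t * cosh (\<mu> * t)\<close>; the
    recurrence then removes the order \<mu> - 1.\<close>
  moreover have "2 * M = bessel_K (\<mu> + 1) x + bessel_K (\<mu> - 1) x"
  proof -
    have "bessel_K (\<mu> + 1) x + bessel_K (\<mu> - 1) x
        = integral {0..} (\<lambda>t. exp (- x * cosh t) * cosh ((\<mu> + 1) * t) + exp (- x * cosh t) * cosh ((\<mu> - 1) * t))"
      unfolding bessel_K_def by (intro integral_add[symmetric] bessel_K_integrable assms)
    also have "\<dots> = integral {0..} (\<lambda>t. 2 * (exp (- x * cosh t) * (cosh t * cosh (\<mu> * t))))"
      by (intro integral_cong) (simp add: distrib_right left_diff_distrib cosh_add cosh_diff algebra_simps)
    finally show ?thesis by (simp add: M_def)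
  qed
  moreover have "2 * \<mu> / x * bessel_K \<mu> x = 2 * (\<mu> / x * bessel_K \<mu> x)" by simp
  ultimately show ?thesis
    using bessel_K_rec[OF assms, of \<mu>] by (elim DERIV_cong) linarith
qed

lemma bessel_K_Suc_deriv:
  assumes "x > 0"
  shows "(bessel_K (\<mu> + 1) has_real_derivative - bessel_K \<mu> x - (\<mu> + 1) / x * bessel_K (\<mu> + 1) x) (at x)"
  by (rule DERIV_cong[OF bessel_K_deriv[OF assms]])
    (use bessel_K_rec[OF assms, of "\<mu> + 1"] assms in \<open>simp add: add.assoc field_simps\<close>)

text \<open>The substitution \<open>s = x / 2 * exp t\<close> gives an upper incomplete Gamma
  integral over \<open>s \<ge> x / 2\<close>; \<open>G\<close> is the lower incomplete Gamma
  function.\<close>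

lemma integral_exp_minus_exp:
  fixes \<mu> x :: real
  assumes "\<mu> > 0" "x > 0"
  defines "G \<equiv> (\<lambda>y. integral {0..y} (\<lambda>s. s powr (\<mu> - 1) / exp s))"
  shows "((\<lambda>t. exp (- (x / 2 * exp t)) * exp (\<mu> * t)) has_integral (2 / x) powr \<mu> * (Gamma \<mu> - G (x / 2))) {0..}"
proof (rule has_integral_to_inf)
  let ?h = "\<lambda>t. exp (- (x / 2 * exp t)) * exp (\<mu> * t)"
  have int: "(\<lambda>s. s powr (\<mu> - 1) / exp s) integrable_on {0..}"
    and Gamma: "integral {0..} (\<lambda>s. s powr (\<mu> - 1) / exp s) = Gamma \<mu>"
    using Gamma_integral_real[OF assms(1)] by (auto simp: has_integral_iff)
  have dG: "(G has_real_derivative y powr (\<mu> - 1) / exp y) (at y)" if "y > 0" for y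
  proof -
    \<comment> \<open>The longer interval makes \<open>y\<close> an interior point, so that the
      derivative within it is the full one.\<close>
    have int': "(\<lambda>s. s powr (\<mu> - 1) / exp s) integrable_on {0..y + 1}"
      using int integrable_on_subinterval by fastforce
    have "isCont (\<lambda>s. s powr (\<mu> - 1) / exp s) y"
      using that by (intro continuous_intros) auto
    then have cont: "continuous (at y within ({0..y + 1} - {})) (\<lambda>s. s powr (\<mu> - 1) / exp s)"
      by (rule continuous_at_imp_continuous_at_within)
    have "(G has_vector_derivative y powr (\<mu> - 1) / exp y) (at y within ({0..y + 1} - {}))"
      unfolding G_def
      by (rule integral_has_vector_derivative_continuous_at[OF int' _ _ cont]) (use that in auto)
    moreover have "at y within {0..y + 1} = at y"
      using that by (intro at_within_Icc_at) auto
    ultimately show ?thesis by (simp add: has_real_derivative_iff_has_vector_derivative)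
  qed
  define F where "F t = (2 / x) powr \<mu> * G (x / 2 * exp t)" for t
  have "(F has_real_derivative ?h t) (at t)" for t
  proof -
    have eq: "(2 / x) powr \<mu> * ((x / 2 * exp t) powr (\<mu> - 1) / exp (x / 2 * exp t) * (x / 2 * exp t)) = ?h t"
    proof -
      have "(x / 2 * exp t) powr (\<mu> - 1) * (x / 2 * exp t) = (x / 2 * exp t) powr \<mu>"
        using assms by (simp add: powr_diff)
      also have "\<dots> = (x / 2) powr \<mu> * exp (\<mu> * t)"
        by (subst powr_mult) (simp add: exp_powr_real mult.commute)
      finally have "(2 / x) powr \<mu> * ((x / 2 * exp t) powr (\<mu> - 1) / exp (x / 2 * exp t) * (x / 2 * exp t))
          = (2 / x) powr \<mu> * ((x / 2) powr \<mu> * exp (\<mu> * t)) / exp (x / 2 * exp t)"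
        by simp
      also have "\<dots> = ?h t"
        using assms by (simp add: exp_minus field_simps flip: powr_mult)
      finally show ?thesis .
    qed
    have "((\<lambda>t. x / 2 * exp t) has_real_derivative x / 2 * exp t) (at t)"
      by (auto intro!: derivative_eq_intros)
    from DERIV_cmult[OF DERIV_chain2[OF dG this]] show ?thesis
      unfolding F_def eq[symmetric] using assms by simp
  qed
  then have FTC: "(?h has_integral F y - F 0) {0..y}" if "y \<ge> 0" for y
    using that by (intro fundamental_theorem_of_calculus)
      (auto simp flip: has_real_derivative_iff_has_vector_derivative intro: has_field_derivative_at_within)
  show "?h integrable_on {0..y}" for y
    by (intro integrable_continuous_real continuous_intros)
  have "filterlim (\<lambda>y. x / 2 * exp y) at_top at_top"
    using assms by real_asymp
  from filterlim_compose[OF tendsto_integral_Ici[OF int] this]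
  have "((\<lambda>y. F y - F 0) \<longlongrightarrow> (2 / x) powr \<mu> * Gamma \<mu> - F 0) at_top"
    unfolding F_def G_def Gamma by (intro tendsto_intros)
  moreover have "\<forall>\<^sub>F y in at_top. F y - F 0 = integral {0..y} ?h"
    using eventually_ge_at_top[of 0] by (rule eventually_mono) (rule integral_unique[OF FTC, symmetric])
  ultimately have "((\<lambda>y. integral {0..y} ?h) \<longlongrightarrow> (2 / x) powr \<mu> * Gamma \<mu> - F 0) at_top"
    by (rule Lim_transform_eventually)
  then show "((\<lambda>y. integral {0..y} ?h) \<longlongrightarrow> (2 / x) powr \<mu> * (Gamma \<mu> - G (x / 2))) at_top"
    by (simp add: F_def algebra_simps)
qed auto

text \<open>A sandwich: near 0 the integral is governed by large \<open>t\<close>, where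
  \<open>cosh t\<close> may be replaced by \<open>exp t / 2\<close>, and this yields the Gamma
  integral.\<close>

lemma powr_times_bessel_K_tendsto:
  assumes "\<mu> > 0"
  shows "((\<lambda>x. x powr \<mu> * bessel_K \<mu> x) \<longlongrightarrow> 2 powr (\<mu> - 1) * Gamma \<mu>) (at_right 0)"
proof -
  define G where "G = (\<lambda>y. integral {0..y} (\<lambda>s. s powr (\<mu> - 1) / exp s))"
  have "((\<lambda>y. G (y / 2)) \<longlongrightarrow> 0) (at_right 0)"
  proof -
    have "(\<lambda>s. s powr (\<mu> - 1) / exp s) integrable_on {0..1}"
      using Gamma_integral_real[OF assms] integrable_on_subinterval by (fastforce simp: has_integral_iff)
    then have "continuous_on {0..1} G"
      unfolding G_def by (rule indefinite_integral_continuous_1)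
    then have "(G \<longlongrightarrow> G 0) (at_right 0)"
      unfolding continuous_on_def using at_within_Icc_at_right[of 0 "1::real"] by force
    moreover have "filterlim (\<lambda>y::real. y / 2) (at_right 0) (at_right 0)" by real_asymp
    ultimately have "((\<lambda>y. G (y / 2)) \<longlongrightarrow> G 0) (at_right 0)" by (rule filterlim_compose)
    then show ?thesis by (simp add: G_def)
  qed
  then have G: "((\<lambda>x. 2 powr (\<mu> - 1) * (Gamma \<mu> - G (x / 2))) \<longlongrightarrow> 2 powr (\<mu> - 1) * (Gamma \<mu> - 0)) (at_right 0)"
    by (intro tendsto_intros)
  have P: "((\<lambda>t. exp (- (x / 2 * exp t)) * exp (\<mu> * t)) has_integral (2 / x) powr \<mu> * (Gamma \<mu> - G (x / 2))) {0..}"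
    if "x > 0" for x
    unfolding G_def using integral_exp_minus_exp[OF assms that] .
  have scale: "x powr \<mu> * ((2 / x) powr \<mu> * y / 2) = 2 powr (\<mu> - 1) * y" if "x > 0" for x y :: real
    using that by (simp add: powr_divide powr_diff)
  \<comment> \<open>The part with \<open>exp (\<mu> * t)\<close> uses
    \<open>cosh t \<ge> exp t / 2\<close>. In the part with \<open>exp (- \<mu> * t)\<close> the
    kernel is bounded by 1, so it contributes at most \<open>1 / (2 * \<mu>)\<close>, which
    \<open>x powr \<mu>\<close> makes vanish.\<close>
  have upper: "x powr \<mu> * bessel_K \<mu> x \<le> 2 powr (\<mu> - 1) * (Gamma \<mu> - G (x / 2)) + x powr \<mu> / (2 * \<mu>)"
    if x: "x > 0" for x
  proof -
    have "((\<lambda>t. (exp (- (x / 2 * exp t)) * exp (\<mu> * t) + exp (- \<mu> * t)) / 2) has_integral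
        ((2 / x) powr \<mu> * (Gamma \<mu> - G (x / 2)) + exp (- \<mu> * 0) / \<mu>) / 2) {0..}"
      by (intro has_integral_divide has_integral_add P x has_integral_exp_minus_to_infinity assms)
    moreover have "exp (- x * cosh t) * cosh (\<mu> * t)
        \<le> (exp (- (x / 2 * exp t)) * exp (\<mu> * t) + exp (- \<mu> * t)) / 2" for t
    proof -
      have "x * (exp t / 2) \<le> x * cosh t" using x by (intro mult_left_mono) (auto simp: cosh_def)
      then have 1: "exp (- x * cosh t) * exp (\<mu> * t) \<le> exp (- (x / 2 * exp t)) * exp (\<mu> * t)"
        by simp
      have 2: "exp (- x * cosh t) * exp (- \<mu> * t) \<le> 1 * exp (- \<mu> * t)"
        using x by (intro mult_right_mono) auto
      have "exp (- x * cosh t) * cosh (\<mu> * t)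
          = (exp (- x * cosh t) * exp (\<mu> * t) + exp (- x * cosh t) * exp (- \<mu> * t)) / 2"
        by (simp add: cosh_def[of "\<mu> * t"] algebra_simps)
      also have "\<dots> \<le> (exp (- (x / 2 * exp t)) * exp (\<mu> * t) + 1 * exp (- \<mu> * t)) / 2"
        by (intro divide_right_mono add_mono 1 2) simp
      finally show ?thesis by simp
    qed
    ultimately have "bessel_K \<mu> x \<le> ((2 / x) powr \<mu> * (Gamma \<mu> - G (x / 2)) + exp (- \<mu> * 0) / \<mu>) / 2"
      unfolding bessel_K_def
      by (intro has_integral_le[OF integrable_integral[OF bessel_K_integrable[OF x]]])
    then have "bessel_K \<mu> x \<le> ((2 / x) powr \<mu> * (Gamma \<mu> - G (x / 2)) + 1 / \<mu>) / 2" by simp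
    then have "x powr \<mu> * bessel_K \<mu> x \<le> x powr \<mu> * (((2 / x) powr \<mu> * (Gamma \<mu> - G (x / 2)) + 1 / \<mu>) / 2)"
      by (intro mult_left_mono) auto
    also have "\<dots> = x powr \<mu> * ((2 / x) powr \<mu> * (Gamma \<mu> - G (x / 2)) / 2) + x powr \<mu> / (2 * \<mu>)"
      by (simp add: field_simps)
    finally show ?thesis by (simp only: scale[OF x])
  qed
  \<comment> \<open>For \<open>t \<ge> 0\<close> one has
    \<open>cosh t \<le> (1 + exp t) / 2\<close>, at the price of a factor
    \<open>exp (- x / 2)\<close> that tends to 1.\<close>
  have lower: "exp (- x / 2) * (2 powr (\<mu> - 1) * (Gamma \<mu> - G (x / 2))) \<le> x powr \<mu> * bessel_K \<mu> x"
    if x: "x > 0" for x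
  proof -
    have "((\<lambda>t. exp (- x / 2) / 2 * (exp (- (x / 2 * exp t)) * exp (\<mu> * t))) has_integral
        exp (- x / 2) / 2 * ((2 / x) powr \<mu> * (Gamma \<mu> - G (x / 2)))) {0..}"
      by (rule has_integral_mult_right[OF P[OF x]])
    moreover have "exp (- x / 2) / 2 * (exp (- (x / 2 * exp t)) * exp (\<mu> * t))
        \<le> exp (- x * cosh t) * cosh (\<mu> * t)" if "t \<in> {0..}" for t
    proof -
      have "x * cosh t \<le> x * ((1 + exp t) / 2)"
        using that x by (intro mult_left_mono) (auto simp: cosh_def)
      then have "exp (- x / 2) * exp (- (x / 2 * exp t)) \<le> exp (- x * cosh t)"
        by (simp add: algebra_simps add_divide_distrib flip: exp_add)
      moreover have "exp (\<mu> * t) / 2 \<le> cosh (\<mu> * t)" by (simp add: cosh_def)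
      ultimately have "exp (- x / 2) * exp (- (x / 2 * exp t)) * (exp (\<mu> * t) / 2) \<le> exp (- x * cosh t) * cosh (\<mu> * t)"
        by (intro mult_mono) auto
      then show ?thesis by simp
    qed
    ultimately have "exp (- x / 2) / 2 * ((2 / x) powr \<mu> * (Gamma \<mu> - G (x / 2))) \<le> bessel_K \<mu> x"
      unfolding bessel_K_def
      by (intro has_integral_le[OF _ integrable_integral[OF bessel_K_integrable[OF x]]])
    then have "x powr \<mu> * (exp (- x / 2) / 2 * ((2 / x) powr \<mu> * (Gamma \<mu> - G (x / 2)))) \<le> x powr \<mu> * bessel_K \<mu> x"
      by (intro mult_left_mono) auto
    also have "x powr \<mu> * (exp (- x / 2) / 2 * ((2 / x) powr \<mu> * (Gamma \<mu> - G (x / 2))))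
        = exp (- x / 2) * (x powr \<mu> * ((2 / x) powr \<mu> * (Gamma \<mu> - G (x / 2)) / 2))"
      by simp
    finally show ?thesis by (simp only: scale[OF x])
  qed
  show ?thesis
  proof (rule tendsto_sandwich)
    show "\<forall>\<^sub>F x in at_right 0. exp (- x / 2) * (2 powr (\<mu> - 1) * (Gamma \<mu> - G (x / 2))) \<le> x powr \<mu> * bessel_K \<mu> x"
      using eventually_at_right_less by (rule eventually_mono) (rule lower)
    show "\<forall>\<^sub>F x in at_right 0. x powr \<mu> * bessel_K \<mu> x \<le> 2 powr (\<mu> - 1) * (Gamma \<mu> - G (x / 2)) + x powr \<mu> / (2 * \<mu>)"
      using eventually_at_right_less by (rule eventually_mono) (rule upper)
    have "((\<lambda>x. exp (- x / 2)) \<longlongrightarrow> (1::real)) (at_right 0)" by real_asymp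
    from tendsto_mult[OF this G]
    show "((\<lambda>x. exp (- x / 2) * (2 powr (\<mu> - 1) * (Gamma \<mu> - G (x / 2)))) \<longlongrightarrow> 2 powr (\<mu> - 1) * Gamma \<mu>) (at_right 0)"
      by simp
    have "((\<lambda>x. x powr \<mu> / (2 * \<mu>)) \<longlongrightarrow> 0) (at_right 0)" using assms by real_asymp
    from tendsto_add[OF G this]
    show "((\<lambda>x. 2 powr (\<mu> - 1) * (Gamma \<mu> - G (x / 2)) + x powr \<mu> / (2 * \<mu>)) \<longlongrightarrow> 2 powr (\<mu> - 1) * Gamma \<mu>) (at_right 0)"
      by simp
  qed
qed

subsection \<open>The Wronskian and products of the two functions\<close>

text \<open>The left side has derivative 0, and its value is found at 0: the first product tends to
  1 by the leading behaviour of I and K, the second to 0 because it is at most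
  \<open>x / (2 * \<nu> + 2)\<close> times the first.\<close>

lemma bessel_wronskian:
  assumes "\<nu> > - 1 / 2" "x > 0"
  shows "x * (bessel_I \<nu> x * bessel_K (\<nu> + 1) x + bessel_I (\<nu> + 1) x * bessel_K \<nu> x) = 1"
proof -
  have nu: "\<nu> > -1" using assms by simp
  let ?A = "\<lambda>x. x * (bessel_I \<nu> x * bessel_K (\<nu> + 1) x)"
  let ?B = "\<lambda>x. x * (bessel_I (\<nu> + 1) x * bessel_K \<nu> x)"
  have deriv: "((\<lambda>x. ?A x + ?B x - 1) has_real_derivative 0) (at x)"
    "((\<lambda>x. 1 - (?A x + ?B x)) has_real_derivative 0) (at x)" if x: "x > 0" for x
    by ((rule derivative_eq_intros bessel_I_deriv[OF nu x] bessel_I_Suc_deriv[OF nu x]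
          bessel_K_deriv[OF x] bessel_K_Suc_deriv[OF x] refl)+,
        use x in \<open>simp add: field_simps\<close>)+
  have A: "(?A \<longlongrightarrow> 1) (at_right 0)"
  proof -
    have "((\<lambda>x. (x powr (-\<nu>) * bessel_I \<nu> x) * (x powr (\<nu> + 1) * bessel_K (\<nu> + 1) x))
        \<longlongrightarrow> 2 powr (-\<nu>) / Gamma (\<nu> + 1) * (2 powr (\<nu> + 1 - 1) * Gamma (\<nu> + 1))) (at_right 0)"
      using assms by (intro tendsto_mult powr_minus_bessel_I_tendsto powr_times_bessel_K_tendsto) auto
    moreover have "Gamma (\<nu> + 1) > 0" using nu by (intro Gamma_real_pos) simp
    then have "2 powr (-\<nu>) / Gamma (\<nu> + 1) * (2 powr (\<nu> + 1 - 1) * Gamma (\<nu> + 1)) = 1"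
      by (simp add: powr_minus)
    ultimately have "((\<lambda>x. (x powr (-\<nu>) * bessel_I \<nu> x) * (x powr (\<nu> + 1) * bessel_K (\<nu> + 1) x))
        \<longlongrightarrow> 1) (at_right 0)" by simp
    then show ?thesis
      by (rule Lim_transform_eventually[OF _ eventually_mono[OF eventually_at_right_less]])
        (simp add: powr_add powr_minus)
  qed
  have B: "(?B \<longlongrightarrow> 0) (at_right 0)"
  proof (rule Lim_null_comparison)
    show "\<forall>\<^sub>F x in at_right 0. norm (?B x) \<le> x / (2 * \<nu> + 2) * ?A x"
      using eventually_at_right_less
    proof (rule eventually_mono)
      fix x :: real assume x: "0 < x"
      have "bessel_I (\<nu> + 1) x \<le> x / (2 * \<nu> + 2) * bessel_I \<nu> x"
        using bessel_I_ratio_upper[OF nu x] nu by (simp add: field_simps)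
      \<comment> \<open>Uses \<open>\<bar>\<nu>\<bar> \<le> \<bar>\<nu> + 1\<bar>\<close>, which
        follows from \<nu> > -1/2.\<close>
      moreover have "bessel_K \<nu> x \<le> bessel_K (\<nu> + 1) x" using assms x by (intro bessel_K_le) auto
      ultimately have "bessel_I (\<nu> + 1) x * bessel_K \<nu> x \<le> x / (2 * \<nu> + 2) * bessel_I \<nu> x * bessel_K (\<nu> + 1) x"
        using x nu bessel_K_pos[OF x] bessel_I_pos[OF nu x] by (intro mult_mono) (auto intro: less_imp_le)
      then have "?B x \<le> x * (x / (2 * \<nu> + 2) * bessel_I \<nu> x * bessel_K (\<nu> + 1) x)"
        using x by (intro mult_left_mono) auto
      moreover have "?B x > 0" using x nu bessel_K_pos[OF x] bessel_I_pos[of "\<nu> + 1" x] by simp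
      ultimately show "norm (?B x) \<le> x / (2 * \<nu> + 2) * ?A x" by (simp add: mult_ac)
    qed
    show "((\<lambda>x. x / (2 * \<nu> + 2) * ?A x) \<longlongrightarrow> 0) (at_right 0)"
    proof -
      have "((\<lambda>x. x / (2 * \<nu> + 2)) \<longlongrightarrow> 0) (at_right 0)" using nu by (auto intro!: tendsto_eq_intros)
      from tendsto_mult[OF this A] show ?thesis by simp
    qed
  qed
  \<comment> \<open>Constancy is obtained by applying the monotonicity principle to the difference
    from 1 with both signs.\<close>
  note lim = tendsto_add[OF A B]
  have "?A x + ?B x - 1 \<ge> 0"
    by (rule DERIV_nonneg_imp_nonneg_at_right_0[OF deriv(1) order_refl _ assms(2)])
      (use tendsto_diff[OF lim tendsto_const[of 1]] in simp_all)
  moreover have "1 - (?A x + ?B x) \<ge> 0"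
    by (rule DERIV_nonneg_imp_nonneg_at_right_0[OF deriv(2) order_refl _ assms(2)])
      (use tendsto_diff[OF tendsto_const[of 1] lim] in simp_all)
  ultimately show ?thesis by (simp add: distrib_left)
qed

lemma times_bessel_K_tendsto_0: "((\<lambda>x. x * bessel_K \<mu> x) \<longlongrightarrow> 0) at_top"
proof (rule Lim_null_comparison)
  show "\<forall>\<^sub>F x in at_top. norm (x * bessel_K \<mu> x) \<le> (x * exp (1 - x)) * bessel_K \<mu> 1"
    using eventually_ge_at_top
  proof (rule eventually_mono)
    fix x :: real assume x: "1 \<le> x"
    then show "norm (x * bessel_K \<mu> x) \<le> (x * exp (1 - x)) * bessel_K \<mu> 1"
      using mult_left_mono[OF bessel_K_exp_decay[OF x, of \<mu>], of x] bessel_K_pos[of x \<mu>] by (simp add: mult_ac)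
  qed
  have "((\<lambda>x::real. x * exp (1 - x)) \<longlongrightarrow> 0) at_top" by real_asymp
  then show "((\<lambda>x. (x * exp (1 - x)) * bessel_K \<mu> 1) \<longlongrightarrow> 0) at_top"
    by (rule tendsto_mult_left_zero)
qed

text \<open>Counterpart of the inequality for I, anchored at infinity: the difference of the two
  sides decreases to the limit 0 there, hence is positive.\<close>

lemma bessel_K_turan:
  assumes "\<nu> > - 1 / 2" "x > 0"
  shows "x * ((bessel_K (\<nu> + 1) x)\<^sup>2 - (bessel_K \<nu> x)\<^sup>2) < (2 * \<nu> + 1) * bessel_K \<nu> x * bessel_K (\<nu> + 1) x"
proof -
  let ?f = "\<lambda>x. x * ((bessel_K \<nu> x)\<^sup>2 - (bessel_K (\<nu> + 1) x)\<^sup>2) + (2 * \<nu> + 1) * bessel_K \<nu> x * bessel_K (\<nu> + 1) x"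
  have "0 < ?f x"
  proof (rule DERIV_neg_imp_decreasing_at_top[where f = ?f])
    fix y assume "x \<le> y"
    then have y: "y > 0" using assms by simp
    have "(?f has_real_derivative - ((2 * \<nu> + 1) / y * bessel_K \<nu> y * bessel_K (\<nu> + 1) y)) (at y)"
      by (rule derivative_eq_intros bessel_K_deriv[OF y] bessel_K_Suc_deriv[OF y] refl)+
        (use y in \<open>simp add: field_simps power2_eq_square\<close>)
    moreover have "(2 * \<nu> + 1) / y * bessel_K \<nu> y * bessel_K (\<nu> + 1) y > 0"
      using assms y bessel_K_pos[OF y] by simp
    ultimately show "\<exists>z. (?f has_real_derivative z) (at y) \<and> z < 0" by (meson neg_less_0_iff_less)
  next
    have inv: "((\<lambda>x::real. 1 / x) \<longlongrightarrow> 0) at_top" by real_asymp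
    have "((\<lambda>x. 1 / x * ((x * bessel_K \<nu> x)\<^sup>2 - (x * bessel_K (\<nu> + 1) x)\<^sup>2)
        + (2 * \<nu> + 1) * (1 / x)\<^sup>2 * ((x * bessel_K \<nu> x) * (x * bessel_K (\<nu> + 1) x))) \<longlongrightarrow> 0) at_top"
      by ((rule times_bessel_K_tendsto_0 inv tendsto_eq_intros refl)+, simp)
    then show "(?f \<longlongrightarrow> 0) at_top"
      by (rule Lim_transform_eventually[OF _ eventually_mono[OF eventually_gt_at_top[of 0]]])
        (simp add: field_simps power2_eq_square)
  qed
  then show ?thesis by (simp add: algebra_simps)
qed

text \<open>The two Turan inequalities, multiplied crosswise, give \<open>j * l < i * k\<close>. As
  the two terms of the Wronskian have the product \<open>(i * k) * (j * l)\<close>, the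
  arithmetic-geometric mean inequality then bounds \<open>j * l\<close> by half of their
  sum.\<close>

lemma times_bessel_I_bessel_K_Suc_less_half:
  assumes "\<nu> > - 1 / 2" "x > 0"
  shows "x * bessel_I (\<nu> + 1) x * bessel_K (\<nu> + 1) x < 1 / 2"
proof -
  define i j k l where "i = bessel_I \<nu> x" "j = bessel_I (\<nu> + 1) x" "k = bessel_K \<nu> x" "l = bessel_K (\<nu> + 1) x"
  note defs = i_j_k_l_def
  have pos: "i > 0" "j > 0" "k > 0" "l > 0"
    using assms by (auto simp: defs intro: bessel_I_pos bessel_K_pos)
  have "x * (l\<^sup>2 - k\<^sup>2) * (i * j) < (2 * \<nu> + 1) * k * l * (i * j)"
    using bessel_K_turan[OF assms] pos by (intro mult_strict_right_mono) (auto simp: defs)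
  also have "\<dots> = (2 * \<nu> + 1) * i * j * (k * l)" by simp
  also have "\<dots> < x * (i\<^sup>2 - j\<^sup>2) * (k * l)"
    using bessel_I_turan[OF assms] pos by (intro mult_strict_right_mono) (auto simp: defs)
  finally have "x * ((l\<^sup>2 - k\<^sup>2) * (i * j)) < x * ((i\<^sup>2 - j\<^sup>2) * (k * l))" by (simp add: mult.assoc)
  then have "(l\<^sup>2 - k\<^sup>2) * (i * j) < (i\<^sup>2 - j\<^sup>2) * (k * l)" using assms by simp
  \<comment> \<open>The difference of the two cross products factors through the positive quantity
    \<open>i * l + j * k\<close>, which can be cancelled.\<close>
  moreover have "i * k * (i * l + j * k) - j * l * (i * l + j * k) = (i\<^sup>2 - j\<^sup>2) * (k * l) - (l\<^sup>2 - k\<^sup>2) * (i * j)"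
    by algebra
  ultimately have "j * l * (i * l + j * k) < i * k * (i * l + j * k)" by linarith
  moreover have "i * l + j * k > 0" using pos by (simp add: add_pos_pos)
  ultimately have "j * l < i * k" by (simp only: mult_less_cancel_right_pos)
  then have less: "(j * l) * (j * l) < (j * l) * (i * k)" using pos by (intro mult_strict_left_mono) auto
  \<comment> \<open>Arithmetic-geometric mean step for the Wronskian terms \<open>i * l\<close> and
    \<open>j * k\<close>.\<close>
  have "(2 * (j * l))\<^sup>2 = 4 * ((j * l) * (j * l))" by algebra
  also have "\<dots> < 4 * ((j * l) * (i * k))" using less by (rule mult_strict_left_mono) simp
  also have "\<dots> = (i * l + j * k)\<^sup>2 - (i * l - j * k)\<^sup>2" by algebra
  also have "\<dots> \<le> (i * l + j * k)\<^sup>2" by simp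
  finally have "2 * (j * l) < i * l + j * k"
    by (rule power2_less_imp_less) (use \<open>i * l + j * k > 0\<close> in simp)
  then have "x * (2 * (j * l)) < x * (i * l + j * k)" using assms by simp
  also have "\<dots> = 1" using bessel_wronskian[OF assms] by (simp add: defs)
  finally show ?thesis by (simp add: defs)
qed

subsection \<open>Comparison bounds for the integral\<close>

definition bessel_integral :: "real \<Rightarrow> real \<Rightarrow> real \<Rightarrow> real" where
  "bessel_integral \<beta> \<nu> x = integral {0..x} (\<lambda>t. exp (\<beta> * t) * t powr \<nu> * bessel_I \<nu> t)"

text \<open>The integrand is a continuous function times \<open>t powr (2 * \<nu>)\<close>, and
  \<open>2 * \<nu> > -1\<close> makes the power integrable at 0.\<close>

lemma bessel_integrand_integrable:
  assumes "\<nu> > - 1 / 2"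
  shows "(\<lambda>t. exp (\<beta> * t) * t powr \<nu> * bessel_I \<nu> t) integrable_on {0..c}"
proof (cases "c \<ge> 0")
  case True
  define g where "g t = exp (\<beta> * t) * (2 powr (-\<nu>) * bessel_series \<nu> (t\<^sup>2 / 4))" for t
  have cont: "continuous_on S g" for S
  proof -
    have "continuous_on UNIV (bessel_series \<nu>)"
      using assms by (intro continuous_at_imp_continuous_on ballI DERIV_isCont[OF bessel_series_deriv]) auto
    then have "continuous_on S (\<lambda>t. bessel_series \<nu> (t\<^sup>2 / 4))"
      by (rule continuous_on_compose2) (auto intro!: continuous_intros)
    then show ?thesis unfolding g_def by (intro continuous_intros)
  qed
  have "compact (g ` {0..c})" by (intro compact_continuous_image cont compact_Icc)
  then obtain M where M: "\<And>t. t \<in> {0..c} \<Longrightarrow> norm (g t) \<le> M"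
    using compact_imp_bounded bounded_iff by (metis imageI)
  have "(\<lambda>t. g t * t powr (2 * \<nu>)) integrable_on {0..c}"
  proof (rule measurable_bounded_by_integrable_imp_integrable)
    have "(\<lambda>t. g t * t powr (2 * \<nu>)) \<in> borel_measurable borel"
      by (intro borel_measurable_times powr_real_measurable borel_measurable_continuous_onI[OF cont]) auto
    then show "(\<lambda>t. g t * t powr (2 * \<nu>)) \<in> borel_measurable (lebesgue_on {0..c})"
      by (intro measurable_restrict_space1 measurable_completion) simp
    have "(\<lambda>t. t powr (2 * \<nu>)) integrable_on {0..c}"
      using has_integral_powr_from_0[of "2 * \<nu>" c] assms True by (auto simp: has_integral_iff)
    then show "(\<lambda>t. M * t powr (2 * \<nu>)) integrable_on {0..c}" by (rule integrable_on_mult_right)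
    show "norm (g t * t powr (2 * \<nu>)) \<le> M * t powr (2 * \<nu>)" if "t \<in> {0..c}" for t
      using M[OF that] by (simp add: abs_mult mult_right_mono)
  qed simp
  moreover have "g t * t powr (2 * \<nu>) = exp (\<beta> * t) * t powr \<nu> * bessel_I \<nu> t" if "t \<in> {0..c}" for t
  \<comment> \<open>At \<open>t = 0\<close> both sides are 0, because \<open>0 powr a = 0\<close>
    for every \<open>a\<close>.\<close>
  proof (cases "t = 0")
    case False
    with that have "t > 0" by simp
    have "t powr (2 * \<nu>) = t powr \<nu> * t powr \<nu>" by (simp flip: powr_add)
    then show ?thesis
      using powr_minus_times_bessel_I[of \<nu> t] \<open>t > 0\<close> assms by (simp add: g_def powr_minus field_simps)
  qed simp
  ultimately show ?thesis by (rule integrable_eq)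
qed auto

lemma bessel_integral_deriv:
  assumes "\<nu> > - 1 / 2" "x > 0"
  shows "(bessel_integral \<beta> \<nu> has_real_derivative exp (\<beta> * x) * x powr \<nu> * bessel_I \<nu> x) (at x)"
proof -
  have "isCont (bessel_I \<nu>) x" using assms by (intro DERIV_isCont[OF bessel_I_deriv]) auto
  then have "isCont (\<lambda>t. exp (\<beta> * t) * t powr \<nu> * bessel_I \<nu> t) x"
    using assms by (intro continuous_intros) auto
  then have cont: "continuous (at x within ({0..x + 1} - {})) (\<lambda>t. exp (\<beta> * t) * t powr \<nu> * bessel_I \<nu> t)"
    by (rule continuous_at_imp_continuous_at_within)
  have "(bessel_integral \<beta> \<nu> has_vector_derivative exp (\<beta> * x) * x powr \<nu> * bessel_I \<nu> x) (at x within ({0..x + 1} - {}))"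
    unfolding bessel_integral_def
    by (rule integral_has_vector_derivative_continuous_at[OF bessel_integrand_integrable[OF assms(1)] _ _ cont])
      (use assms in auto)
  moreover have "at x within {0..x + 1} = at x"
    using assms by (intro at_within_Icc_at) auto
  ultimately show ?thesis by (simp add: has_real_derivative_iff_has_vector_derivative)
qed

lemma bessel_integral_tendsto_0:
  assumes "\<nu> > - 1 / 2"
  shows "(bessel_integral \<beta> \<nu> \<longlongrightarrow> 0) (at_right 0)"
proof -
  have "continuous_on {0..1} (bessel_integral \<beta> \<nu>)"
    unfolding bessel_integral_def
    by (rule indefinite_integral_continuous_1[OF bessel_integrand_integrable[OF assms]])
  then have "(bessel_integral \<beta> \<nu> \<longlongrightarrow> bessel_integral \<beta> \<nu> 0) (at_right 0)"
    unfolding continuous_on_def using at_within_Icc_at_right[of 0 "1::real"] by force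
  then show ?thesis by (simp add: bessel_integral_def)
qed

text \<open>Comparison principle: it suffices to compare derivatives, since both functions tend to 0
  at 0.\<close>

lemma bessel_integral_le:
  assumes "\<nu> > - 1 / 2" "x > 0"
    and deriv: "\<And>x. x > 0 \<Longrightarrow> (F has_real_derivative F' x) (at x)"
    and le: "\<And>x. x > 0 \<Longrightarrow> exp (\<beta> * x) * x powr \<nu> * bessel_I \<nu> x \<le> F' x"
    and lim: "(F \<longlongrightarrow> 0) (at_right 0)"
  shows "bessel_integral \<beta> \<nu> x \<le> F x"
proof -
  have "F x - bessel_integral \<beta> \<nu> x \<ge> 0"
  proof (rule DERIV_nonneg_imp_nonneg_at_right_0[where f = "\<lambda>x. F x - bessel_integral \<beta> \<nu> x"])
    show "((\<lambda>x. F x - bessel_integral \<beta> \<nu> x) has_real_derivative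
        F' x - exp (\<beta> * x) * x powr \<nu> * bessel_I \<nu> x) (at x)" if "x > 0" for x
      by (intro DERIV_diff deriv bessel_integral_deriv assms that)
    show "((\<lambda>x. F x - bessel_integral \<beta> \<nu> x) \<longlongrightarrow> 0) (at_right 0)"
      using tendsto_diff[OF lim bessel_integral_tendsto_0[OF assms(1)]] by simp
  qed (use le assms in auto)
  then show ?thesis by simp
qed

lemma bessel_integral_ge:
  assumes "\<nu> > - 1 / 2" "x > 0"
    and deriv: "\<And>x. x > 0 \<Longrightarrow> (F has_real_derivative F' x) (at x)"
    and le: "\<And>x. x > 0 \<Longrightarrow> F' x \<le> exp (\<beta> * x) * x powr \<nu> * bessel_I \<nu> x"
    and lim: "(F \<longlongrightarrow> 0) (at_right 0)"
  shows "F x \<le> bessel_integral \<beta> \<nu> x"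
proof -
  have "bessel_integral \<beta> \<nu> x - F x \<ge> 0"
  proof (rule DERIV_nonneg_imp_nonneg_at_right_0[where f = "\<lambda>x. bessel_integral \<beta> \<nu> x - F x"])
    show "((\<lambda>x. bessel_integral \<beta> \<nu> x - F x) has_real_derivative
        exp (\<beta> * x) * x powr \<nu> * bessel_I \<nu> x - F' x) (at x)" if "x > 0" for x
      by (intro DERIV_diff deriv bessel_integral_deriv assms that)
    show "((\<lambda>x. bessel_integral \<beta> \<nu> x - F x) \<longlongrightarrow> 0) (at_right 0)"
      using tendsto_diff[OF bessel_integral_tendsto_0[OF assms(1)] lim] by simp
  qed (use le assms in auto)
  then show ?thesis by simp
qed

lemma bessel_integral_nonneg:
  assumes "\<nu> > - 1 / 2" "x > 0"
  shows "bessel_integral \<beta> \<nu> x \<ge> 0"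
proof (rule bessel_integral_ge[where F = "\<lambda>_. 0" and F' = "\<lambda>_. 0"])
  fix x :: real assume "x > 0"
  then show "0 \<le> exp (\<beta> * x) * x powr \<nu> * bessel_I \<nu> x"
    using assms bessel_I_pos[of \<nu> x] by simp
qed (use assms in auto)

text \<open>The derivative is written as a polynomial in the reciprocal, so that later identities
  follow by \<open>algebra\<close> from the equation reciprocal times denominator = 1.\<close>

lemma reciprocal_affine_deriv:
  fixes a b x :: real
  assumes "a + b * x \<noteq> 0"
  shows "((\<lambda>x. 1 / (a + b * x)) has_real_derivative - (b * (1 / (a + b * x))\<^sup>2)) (at x)"
proof -
  have "((\<lambda>x. a + b * x) has_real_derivative b) (at x)" by (auto intro!: derivative_eq_intros)
  from DERIV_inverse'[OF this assms] show ?thesis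
    by (simp add: power2_eq_square divide_inverse mult_ac)
qed

lemma reciprocal_affine_tendsto:
  fixes a b :: real
  assumes "a \<noteq> 0"
  shows "((\<lambda>x. 1 / (a + b * x)) \<longlongrightarrow> 1 / a) (at_right 0)"
  using assms by (auto intro!: tendsto_eq_intros)

section \<open>Explicit majorants and minorants of the integral\<close>

lemma powr_bessel_I_Suc_deriv:
  assumes "\<nu> > -1" "x > 0"
  shows "((\<lambda>x. x powr \<nu> * bessel_I (\<nu> + 1) x) has_real_derivative
    x powr \<nu> * (bessel_I \<nu> x - bessel_I (\<nu> + 1) x / x)) (at x)"
  by (rule derivative_eq_intros bessel_I_Suc_deriv[OF assms] assms(2) refl)+
    (use assms in \<open>simp add: powr_diff field_simps\<close>)

text \<open>With \<open>q = ?j / x\<close>, the derivative comparison is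
  \<open>?i \<le> A * (?i - q + \<beta> * ?j)\<close>. It follows from
  \<open>(2 * \<nu> + 2) * q \<le> ?i\<close> and \<open>?j + q \<le> ?i\<close>.\<close>

lemma bessel_integral_le_exp:
  assumes "\<nu> \<ge> 1 / 2" "x > 0" "-1 < \<beta>" "\<beta> < 0"
  shows "bessel_integral \<beta> \<nu> x
    \<le> exp (\<beta> * x) * ((2 * \<nu> + 2) / ((2 * \<nu> + 1) * (1 + \<beta>)) * (x powr \<nu> * bessel_I (\<nu> + 1) x))"
proof (rule bessel_integral_le)
  have nu: "\<nu> > -1" using assms by simp
  define A where "A = (2 * \<nu> + 2) / ((2 * \<nu> + 1) * (1 + \<beta>))"
  let ?F' = "\<lambda>x. exp (\<beta> * x) * x powr \<nu> * (A * (bessel_I \<nu> x - bessel_I (\<nu> + 1) x / x + \<beta> * bessel_I (\<nu> + 1) x))"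
  fix x :: real assume x: "x > 0"
  show "((\<lambda>x. exp (\<beta> * x) * ((2 * \<nu> + 2) / ((2 * \<nu> + 1) * (1 + \<beta>)) * (x powr \<nu> * bessel_I (\<nu> + 1) x))) has_real_derivative ?F' x) (at x)"
    unfolding A_def[symmetric]
    by (rule powr_bessel_I_Suc_deriv[OF nu x] derivative_eq_intros refl)+ (simp add: algebra_simps)
  let ?i = "bessel_I \<nu> x" and ?j = "bessel_I (\<nu> + 1) x"
  define q where "q = ?j / x"
  have "(2 * \<nu> + 2) * q \<le> ?i" using bessel_I_ratio_upper[OF nu x] x by (simp add: q_def field_simps)
  then have "(1 + \<beta>) * ((2 * \<nu> + 1) * ?i) \<le> (1 + \<beta>) * ((2 * \<nu> + 2) * (?i - q))"
    using assms by (intro mult_left_mono) (auto simp: algebra_simps)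
  \<comment> \<open>The order bound \<nu> \<ge> 1/2 enters through this inequality; as \<beta> < 0,
    it allows \<open>\<beta> * (?i - q)\<close> to be replaced by the larger
    \<open>\<beta> * ?j\<close>.\<close>
  also have "?j + q \<le> ?i" using bessel_I_Suc_le[OF assms(1) x] x by (simp add: q_def field_simps)
  then have "(2 * \<nu> + 2) * (- \<beta> * (?i - q - ?j)) \<ge> 0"
    using assms by (intro mult_nonneg_nonneg) auto
  then have "(1 + \<beta>) * ((2 * \<nu> + 2) * (?i - q)) \<le> (2 * \<nu> + 2) * (?i - q + \<beta> * ?j)"
    by (simp add: algebra_simps)
  finally have "?i * ((2 * \<nu> + 1) * (1 + \<beta>)) \<le> (2 * \<nu> + 2) * (?i - q + \<beta> * ?j)"
    by (simp only: mult_ac)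
  moreover have "(2 * \<nu> + 1) * (1 + \<beta>) > 0" using assms by simp
  ultimately have "?i \<le> A * (?i - q + \<beta> * ?j)"
    unfolding A_def times_divide_eq_left by (subst pos_le_divide_eq)
  then show "exp (\<beta> * x) * x powr \<nu> * ?i \<le> ?F' x"
    unfolding q_def by (intro mult_left_mono) auto
next
  have lim: "((\<lambda>x. x powr \<nu> * bessel_I (\<nu> + 1) x) \<longlongrightarrow> 0) (at_right 0)"
    using assms by (intro powr_times_bessel_I_tendsto_0) auto
  show "((\<lambda>x. exp (\<beta> * x) * ((2 * \<nu> + 2) / ((2 * \<nu> + 1) * (1 + \<beta>)) * (x powr \<nu> * bessel_I (\<nu> + 1) x))) \<longlongrightarrow> 0) (at_right 0)"
    by ((rule lim tendsto_eq_intros refl)+, simp)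
qed (use assms in auto)

text \<open>With \<open>z = (1 + \<beta>) * x * r x\<close>, which equals \<open>1 - r x\<close>,
  the comparison becomes \<open>i \<le> z\<^sup>2 * c * (i + j) + 2 * r x * i\<close>. It holds
  because \<open>z\<^sup>2 + 2 * r x = 1 + (r x)\<^sup>2\<close> and
  \<open>c \<ge> 1\<close>.\<close>

lemma bessel_integral_le_exp':
  assumes "- 1 / 2 < \<nu>" "\<nu> \<le> 1 / 2" "x > 0" "-1 < \<beta>" "\<beta> < 0"
  shows "bessel_integral \<beta> \<nu> x
    \<le> exp (\<beta> * x) * (2 / (2 * \<nu> + 1) / (1 + (1 + \<beta>) * x) * (x powr (\<nu> + 1) * (bessel_I \<nu> x + bessel_I (\<nu> + 1) x)))"
proof (rule bessel_integral_le)
  have nu: "\<nu> > -1" using assms by simp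
  let ?G = "\<lambda>x. x powr (\<nu> + 1) * (bessel_I \<nu> x + bessel_I (\<nu> + 1) x)"
  define c where "c = 2 / (2 * \<nu> + 1)"
  \<comment> \<open>The bound \<open>c \<ge> 1\<close> is where \<nu> \<le> 1/2 enters.\<close>
  have c: "c * (2 * \<nu> + 1) = 2" "c \<ge> 1" using assms by (auto simp: c_def field_simps)
  define r where "r x = 1 / (1 + (1 + \<beta>) * x)" for x
  let ?F' = "\<lambda>x. exp (\<beta> * x) * (c * (1 + \<beta>)\<^sup>2 * x * (r x)\<^sup>2 * ?G x + 2 * r x * (x powr \<nu> * bessel_I \<nu> x))"
  fix x :: real assume x: "x > 0"
  have "1 + (1 + \<beta>) * x > 0" using assms x by (simp add: add_pos_pos)
  then have r: "r x * (1 + (1 + \<beta>) * x) = 1" "r x > 0"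
    and r': "(r has_real_derivative - ((1 + \<beta>) * (r x)\<^sup>2)) (at x)"
    using reciprocal_affine_deriv[of 1 "1 + \<beta>" x] by (auto simp: r_def[abs_def])
  have G: "(?G has_real_derivative ?G x + (2 * \<nu> + 1) * (x powr \<nu> * bessel_I \<nu> x)) (at x)"
    by (rule bessel_I_deriv[OF nu x] bessel_I_Suc_deriv[OF nu x] x derivative_eq_intros refl)+
      (use x in \<open>simp add: powr_add powr_diff field_simps\<close>)
  \<comment> \<open>The product rule on the left; free variables stand for the transcendental
    factors, so that only the relations for \<open>r x\<close> and \<open>c\<close> are
    needed.\<close>
  have eq: "e * (\<beta> * (c * r x * g) + c * r x * (g + (2 * \<nu> + 1) * y) + c * (- ((1 + \<beta>) * (r x)\<^sup>2)) * g)
      = e * (c * (1 + \<beta>)\<^sup>2 * x * (r x)\<^sup>2 * g + 2 * r x * y)" for e g y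
    using r(1) c(1) by algebra
  have "((\<lambda>x. exp (\<beta> * x) * (c * r x * ?G x)) has_real_derivative ?F' x) (at x)"
    unfolding eq[symmetric]
    by (rule G r' derivative_eq_intros refl)+ (simp add: algebra_simps)
  then show "((\<lambda>x. exp (\<beta> * x) * (2 / (2 * \<nu> + 1) / (1 + (1 + \<beta>) * x) * ?G x)) has_real_derivative ?F' x) (at x)"
    by (simp add: c_def r_def)
  let ?i = "bessel_I \<nu> x" and ?j = "bessel_I (\<nu> + 1) x"
  let ?z = "(1 + \<beta>) * x * r x"
  have pos: "?i > 0" "?j > 0" using nu x by (auto intro: bessel_I_pos)
  have "?i = ?z\<^sup>2 * ?i + 2 * r x * ?i - (r x)\<^sup>2 * ?i" using r(1) by algebra
  also have "\<dots> \<le> ?z\<^sup>2 * ?i + 2 * r x * ?i" using pos by simp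
  also have "?z\<^sup>2 * ?i \<le> ?z\<^sup>2 * (c * (?i + ?j))"
  proof (rule mult_left_mono)
    have "1 * ?i \<le> c * (?i + ?j)" using pos c by (intro mult_mono) auto
    then show "?i \<le> c * (?i + ?j)" by simp
  qed simp
  finally have "?i \<le> ?z\<^sup>2 * (c * (?i + ?j)) + 2 * r x * ?i" by simp
  then have "exp (\<beta> * x) * x powr \<nu> * ?i \<le> exp (\<beta> * x) * x powr \<nu> * (?z\<^sup>2 * (c * (?i + ?j)) + 2 * r x * ?i)"
    by (intro mult_left_mono) auto
  also have "\<dots> = ?F' x"
    using x by (simp add: powr_add power2_eq_square algebra_simps)
  finally show "exp (\<beta> * x) * x powr \<nu> * ?i \<le> ?F' x" .
next
  have lim: "((\<lambda>x. x powr (\<nu> + 1) * bessel_I (\<nu> + 1) x) \<longlongrightarrow> 0) (at_right 0)"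
    "((\<lambda>x. x powr (\<nu> + 1) * bessel_I \<nu> x) \<longlongrightarrow> 0) (at_right 0)"
    using assms by (auto intro!: powr_times_bessel_I_tendsto_0)
  have "((\<lambda>x. exp (\<beta> * x) * (2 / (2 * \<nu> + 1) * (1 / (1 + (1 + \<beta>) * x))
      * (x powr (\<nu> + 1) * bessel_I \<nu> x + x powr (\<nu> + 1) * bessel_I (\<nu> + 1) x))) \<longlongrightarrow> 0) (at_right 0)"
    by ((rule lim reciprocal_affine_tendsto[OF one_neq_zero] tendsto_eq_intros refl)+, simp)
  then show "((\<lambda>x. exp (\<beta> * x) * (2 / (2 * \<nu> + 1) / (1 + (1 + \<beta>) * x) * (x powr (\<nu> + 1) * (bessel_I \<nu> x + bessel_I (\<nu> + 1) x))))
      \<longlongrightarrow> 0) (at_right 0)"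
    by (simp add: distrib_left)
qed (use assms in auto)

text \<open>Bounding \<open>exp (\<beta> * x)\<close> by 1 avoids the factor
  \<open>1 / (1 + \<beta>)\<close>; the remaining constant is the right one as \<open>x\<close>
  tends to 0.\<close>

lemma bessel_integral_le_near_0:
  assumes "\<nu> > - 1 / 2" "x > 0" "\<beta> \<le> 0"
  shows "bessel_integral \<beta> \<nu> x \<le> (2 * \<nu> + 2) / (2 * \<nu> + 1) * (x powr \<nu> * bessel_I (\<nu> + 1) x)"
proof (rule bessel_integral_le)
  have nu: "\<nu> > -1" using assms by simp
  let ?A = "(2 * \<nu> + 2) / (2 * \<nu> + 1)"
  let ?F' = "\<lambda>x. ?A * (x powr \<nu> * (bessel_I \<nu> x - bessel_I (\<nu> + 1) x / x))"
  fix x :: real assume x: "x > 0"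
  show "((\<lambda>x. ?A * (x powr \<nu> * bessel_I (\<nu> + 1) x)) has_real_derivative ?F' x) (at x)"
    by (intro DERIV_cmult powr_bessel_I_Suc_deriv nu x)
  let ?i = "bessel_I \<nu> x" and ?q = "bessel_I (\<nu> + 1) x / x"
  have "(2 * \<nu> + 2) * ?q \<le> ?i" using bessel_I_ratio_upper[OF nu x] x by (simp add: field_simps)
  then have "?i \<le> ?A * (?i - ?q)" using assms by (simp add: field_simps)
  moreover have "exp (\<beta> * x) * ?i \<le> 1 * ?i"
    using assms x bessel_I_pos[OF nu x] by (intro mult_right_mono) (auto simp: mult_le_0_iff)
  ultimately have "exp (\<beta> * x) * ?i \<le> ?A * (?i - ?q)" by simp
  then have "x powr \<nu> * (exp (\<beta> * x) * ?i) \<le> x powr \<nu> * (?A * (?i - ?q))" by (intro mult_left_mono) auto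
  then show "exp (\<beta> * x) * x powr \<nu> * ?i \<le> ?F' x" by (simp add: mult_ac)
next
  have lim: "((\<lambda>x. x powr \<nu> * bessel_I (\<nu> + 1) x) \<longlongrightarrow> 0) (at_right 0)"
    using assms by (intro powr_times_bessel_I_tendsto_0) auto
  show "((\<lambda>x. (2 * \<nu> + 2) / (2 * \<nu> + 1) * (x powr \<nu> * bessel_I (\<nu> + 1) x)) \<longlongrightarrow> 0) (at_right 0)"
    by ((rule lim tendsto_eq_intros refl)+, simp)
qed (use assms in auto)

text \<open>Minorant with the matching constant at 0. The decreasing factor and the exponential add
  only nonpositive terms to the derivative; what remains,
  \<open>(1 + r x) * (?i - ?j / x) \<le> ?i\<close>, is \<open>bessel_I_ratio_lower\<close>
  rearranged.\<close>

lemma bessel_integral_ge_near_0: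
  assumes "\<nu> > - 1 / 2" "x > 0" "\<beta> \<le> 0"
  shows "exp (\<beta> * x) * ((1 + 1 / (2 * \<nu> + 1 + 1 * x)) * (x powr \<nu> * bessel_I (\<nu> + 1) x)) \<le> bessel_integral \<beta> \<nu> x"
proof (rule bessel_integral_ge)
  have nu: "\<nu> > -1" using assms by simp
  define r where "r x = 1 / (2 * \<nu> + 1 + 1 * x)" for x
  let ?F' = "\<lambda>x. exp (\<beta> * x) * x powr \<nu> * ((1 + r x) * (bessel_I \<nu> x - bessel_I (\<nu> + 1) x / x)
    - (r x)\<^sup>2 * bessel_I (\<nu> + 1) x + \<beta> * (1 + r x) * bessel_I (\<nu> + 1) x)"
  fix x :: real assume x: "x > 0"
  have r: "r x * (2 * \<nu> + 1 + x) = 1" "r x > 0"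
    and r': "(r has_real_derivative - (1 * (r x)\<^sup>2)) (at x)"
    using reciprocal_affine_deriv[of "2 * \<nu> + 1" 1 x] x assms by (auto simp: r_def[abs_def])
  show "((\<lambda>x. exp (\<beta> * x) * ((1 + 1 / (2 * \<nu> + 1 + 1 * x)) * (x powr \<nu> * bessel_I (\<nu> + 1) x))) has_real_derivative ?F' x) (at x)"
    unfolding r_def[symmetric]
    by (rule r' powr_bessel_I_Suc_deriv[OF nu x] derivative_eq_intros refl)+ (simp add: algebra_simps)
  let ?i = "bessel_I \<nu> x" and ?j = "bessel_I (\<nu> + 1) x"
  have j: "?j > 0" using nu x by (intro bessel_I_pos) auto
  have "(1 + r x) * (x * ?i - ?j) = x * ?i + r x * (x * ?i - (2 * \<nu> + 2 + x) * ?j)"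
    using r(1) by algebra
  also have "\<dots> \<le> x * ?i"
    using bessel_I_ratio_lower[OF nu x] r(2) by (simp add: mult_le_0_iff)
  finally have "(1 + r x) * (?i - ?j / x) \<le> ?i" using x by (simp add: field_simps)
  moreover have "(r x)\<^sup>2 * ?j \<ge> 0" using j by simp
  moreover have "- \<beta> * (1 + r x) * ?j \<ge> 0" using j r assms by (intro mult_nonneg_nonneg) auto
  ultimately have "(1 + r x) * (?i - ?j / x) - (r x)\<^sup>2 * ?j + \<beta> * (1 + r x) * ?j \<le> ?i" by linarith
  then show "?F' x \<le> exp (\<beta> * x) * x powr \<nu> * ?i" by (intro mult_left_mono) auto
next
  have lim: "((\<lambda>x. x powr \<nu> * bessel_I (\<nu> + 1) x) \<longlongrightarrow> 0) (at_right 0)"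
    using assms by (intro powr_times_bessel_I_tendsto_0) auto
  have "2 * \<nu> + 1 \<noteq> 0" using assms by simp
  note r = reciprocal_affine_tendsto[OF this, of 1]
  show "((\<lambda>x. exp (\<beta> * x) * ((1 + 1 / (2 * \<nu> + 1 + 1 * x)) * (x powr \<nu> * bessel_I (\<nu> + 1) x))) \<longlongrightarrow> 0) (at_right 0)"
    by ((rule lim r tendsto_eq_intros refl)+, simp)
qed (use assms in auto)

text \<open>The factor \<open>x / (2 * \<nu> + 2 + (1 + \<beta>) * x)\<close> tends to
  \<open>1 / (1 + \<beta>)\<close> at infinity. In
  \<open>?i + \<beta> * ?j = (1 + \<beta>) * ?i - \<beta> * (?i - ?j)\<close> the last term, times
  \<open>x\<close>, is at most \<open>(2 * \<nu> + 2) * ?i\<close>, which the denominator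
  absorbs.\<close>

lemma bessel_integral_ge_at_top:
  assumes "\<nu> > - 1 / 2" "x > 0" "-1 < \<beta>" "\<beta> < 0"
  shows "exp (\<beta> * x) * (1 / (2 * \<nu> + 2 + (1 + \<beta>) * x) * (x powr (\<nu> + 1) * bessel_I (\<nu> + 1) x)) \<le> bessel_integral \<beta> \<nu> x"
proof (rule bessel_integral_ge)
  have nu: "\<nu> > -1" using assms by simp
  define r where "r x = 1 / (2 * \<nu> + 2 + (1 + \<beta>) * x)" for x
  let ?F' = "\<lambda>x. exp (\<beta> * x) * x powr \<nu> * (r x * (x * (bessel_I \<nu> x + \<beta> * bessel_I (\<nu> + 1) x))
    - (1 + \<beta>) * x * bessel_I (\<nu> + 1) x * (r x)\<^sup>2)"
  fix x :: real assume x: "x > 0"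
  have "(1 + \<beta>) * x > 0" using assms x by simp
  then have d: "2 * \<nu> + 2 + (1 + \<beta>) * x > 0" using nu by simp
  then have r: "r x * (2 * \<nu> + 2 + (1 + \<beta>) * x) = 1" "r x > 0"
    and r': "(r has_real_derivative - ((1 + \<beta>) * (r x)\<^sup>2)) (at x)"
    using reciprocal_affine_deriv[of "2 * \<nu> + 2" "1 + \<beta>" x] by (auto simp: r_def[abs_def])
  have G: "((\<lambda>x. x powr (\<nu> + 1) * bessel_I (\<nu> + 1) x) has_real_derivative x powr \<nu> * (x * bessel_I \<nu> x)) (at x)"
    by (rule bessel_I_Suc_deriv[OF nu x] x derivative_eq_intros refl)+
      (use x in \<open>simp add: powr_add powr_diff field_simps\<close>)
  have powr: "x powr (\<nu> + 1) = x powr \<nu> * x" using x by (simp add: powr_add)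
  show "((\<lambda>x. exp (\<beta> * x) * (1 / (2 * \<nu> + 2 + (1 + \<beta>) * x) * (x powr (\<nu> + 1) * bessel_I (\<nu> + 1) x))) has_real_derivative ?F' x) (at x)"
    unfolding r_def[symmetric]
    by (rule r' G derivative_eq_intros refl)+ (simp only: powr, simp add: algebra_simps)
  let ?i = "bessel_I \<nu> x" and ?j = "bessel_I (\<nu> + 1) x"
  have j: "?j > 0" using nu x by (intro bessel_I_pos) auto
  have ji: "?j < ?i" using bessel_I_Suc_less[OF assms(1) x] .
  have "x * (?i - ?j) \<le> (2 * \<nu> + 2) * ?j"
    using bessel_I_ratio_lower[OF nu x] by (simp add: algebra_simps)
  also have "\<dots> \<le> (2 * \<nu> + 2) * ?i" using ji nu by (intro mult_left_mono) auto
  finally have "x * (?i - ?j) \<le> (2 * \<nu> + 2) * ?i" .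
  moreover have "- \<beta> * (x * (?i - ?j)) \<le> 1 * (x * (?i - ?j))"
    using assms x ji by (intro mult_right_mono) auto
  ultimately have "- \<beta> * (x * (?i - ?j)) \<le> (2 * \<nu> + 2) * ?i" by simp
  then have "x * (?i + \<beta> * ?j) \<le> ?i * (2 * \<nu> + 2 + (1 + \<beta>) * x)" by (simp add: algebra_simps)
  then have "r x * (x * (?i + \<beta> * ?j)) \<le> r x * (?i * (2 * \<nu> + 2 + (1 + \<beta>) * x))"
    using r(2) by (intro mult_left_mono) auto
  also have "\<dots> = ?i" using r(1) by algebra
  finally have "r x * (x * (?i + \<beta> * ?j)) \<le> ?i" .
  moreover have "(1 + \<beta>) * x * ?j * (r x)\<^sup>2 \<ge> 0" using assms x j by simp
  ultimately have "r x * (x * (?i + \<beta> * ?j)) - (1 + \<beta>) * x * ?j * (r x)\<^sup>2 \<le> ?i" by linarith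
  then show "?F' x \<le> exp (\<beta> * x) * x powr \<nu> * ?i" by (intro mult_left_mono) auto
next
  have lim: "((\<lambda>x. x powr (\<nu> + 1) * bessel_I (\<nu> + 1) x) \<longlongrightarrow> 0) (at_right 0)"
    using assms by (intro powr_times_bessel_I_tendsto_0) auto
  have "2 * \<nu> + 2 \<noteq> 0" using assms by simp
  note r = reciprocal_affine_tendsto[OF this, of "1 + \<beta>"]
  show "((\<lambda>x. exp (\<beta> * x) * (1 / (2 * \<nu> + 2 + (1 + \<beta>) * x) * (x powr (\<nu> + 1) * bessel_I (\<nu> + 1) x))) \<longlongrightarrow> 0) (at_right 0)"
    by ((rule lim r tendsto_eq_intros refl)+, simp)
qed (use assms in auto)

subsection \<open>Bounds for the product\<close>

lemma KI_product_pos: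
  assumes "x > 0"
  shows "KI_product \<beta> \<nu> \<mu> x = exp (- \<beta> * x) * bessel_K \<mu> x / x powr (\<nu> - 1) * bessel_integral \<beta> \<nu> x"
  using assms by (simp add: KI_product_def extend_0_def bessel_integral_def)

text \<open>\<open>Lim\<close> is meaningful only once a limit is known to exist; hence the
  existence of the limit is a premise.\<close>

lemma KI_product_0:
  assumes "(KI_product \<beta> \<nu> \<mu> \<longlongrightarrow> L) (at_right 0)"
  shows "KI_product \<beta> \<nu> \<mu> 0 = L"
proof -
  have "KI_product \<beta> \<nu> \<mu> 0 = Lim (at_right 0) (KI_product \<beta> \<nu> \<mu>)"
    unfolding KI_product_def extend_0_def
    by (simp, rule Lim_cong) (auto simp: eventually_at_right_less[THEN eventually_mono])
  then show ?thesis using assms by (simp add: tendsto_Lim)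
qed

text \<open>Exponentials and powers cancel against the prefactor, leaving one factor
  \<open>x\<close>, so bounds reduce to products of I and K.\<close>

lemma KI_product_le:
  assumes "x > 0" and "bessel_integral \<beta> \<nu> x \<le> exp (\<beta> * x) * (x powr \<nu> * B)"
  shows "KI_product \<beta> \<nu> \<mu> x \<le> x * bessel_K \<mu> x * B"
proof -
  have "KI_product \<beta> \<nu> \<mu> x \<le> exp (- \<beta> * x) * bessel_K \<mu> x / x powr (\<nu> - 1) * (exp (\<beta> * x) * (x powr \<nu> * B))"
    unfolding KI_product_pos[OF assms(1)]
    using assms bessel_K_pos[OF assms(1), of \<mu>] by (intro mult_left_mono) auto
  also have "\<dots> = x * bessel_K \<mu> x * B"
    using assms(1) by (simp add: powr_diff exp_minus)
  finally show ?thesis .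
qed

lemma KI_product_ge:
  assumes "x > 0" and "exp (\<beta> * x) * (x powr \<nu> * B) \<le> bessel_integral \<beta> \<nu> x"
  shows "x * bessel_K \<mu> x * B \<le> KI_product \<beta> \<nu> \<mu> x"
proof -
  have "x * bessel_K \<mu> x * B = exp (- \<beta> * x) * bessel_K \<mu> x / x powr (\<nu> - 1) * (exp (\<beta> * x) * (x powr \<nu> * B))"
    using assms(1) by (simp add: powr_diff exp_minus)
  also have "\<dots> \<le> KI_product \<beta> \<nu> \<mu> x"
    unfolding KI_product_pos[OF assms(1)]
    using assms bessel_K_pos[OF assms(1), of \<mu>] by (intro mult_left_mono) auto
  finally show ?thesis .
qed

lemma KI_product_nonneg:
  assumes "\<nu> > - 1 / 2" "x > 0"
  shows "KI_product \<beta> \<nu> \<mu> x \<ge> 0"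
  using bessel_integral_nonneg[OF assms] bessel_K_pos[OF assms(2), of \<mu>] assms(2)
  by (simp add: KI_product_pos)

lemma KI_product_mono:
  assumes "\<nu> > - 1 / 2" "x > 0" "bessel_K \<mu> x \<le> C * bessel_K \<mu>' x"
  shows "KI_product \<beta> \<nu> \<mu> x \<le> C * KI_product \<beta> \<nu> \<mu>' x"
proof -
  have "bessel_K \<mu> x * (exp (- \<beta> * x) / x powr (\<nu> - 1) * bessel_integral \<beta> \<nu> x)
      \<le> C * bessel_K \<mu>' x * (exp (- \<beta> * x) / x powr (\<nu> - 1) * bessel_integral \<beta> \<nu> x)"
    using assms bessel_integral_nonneg[OF assms(1,2)] by (intro mult_right_mono) auto
  then show ?thesis using assms(2) by (simp add: KI_product_pos mult_ac)
qed

text \<open>Drops the other, positive term of the Wronskian identity.\<close>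

lemma times_bessel_I_Suc_bessel_K_less_1:
  assumes "\<nu> > - 1 / 2" "x > 0"
  shows "x * bessel_I \<nu> x * bessel_K (\<nu> + 1) x < 1"
proof -
  have "x * (bessel_I (\<nu> + 1) x * bessel_K \<nu> x) > 0"
    using assms bessel_I_pos[of "\<nu> + 1" x] bessel_K_pos[of x \<nu>] by simp
  then show ?thesis using bessel_wronskian[OF assms] by (simp add: distrib_left)
qed

lemma KI_product_bound_ge_half:
  assumes "\<nu> \<ge> 1 / 2" "x > 0" "-1 < \<beta>" "\<beta> < 0"
  defines "A \<equiv> (2 * \<nu> + 2) / ((2 * \<nu> + 1) * (1 + \<beta>))"
  shows "KI_product \<beta> \<nu> (\<nu> + 2) x < A" "KI_product \<beta> \<nu> (\<nu> + 1) x \<le> A / 2"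
proof -
  have A: "A > 0" unfolding A_def using assms by (intro divide_pos_pos mult_pos_pos) auto
  have "bessel_integral \<beta> \<nu> x \<le> exp (\<beta> * x) * (x powr \<nu> * (A * bessel_I (\<nu> + 1) x))"
    using bessel_integral_le_exp[OF assms(1-4)] by (simp add: A_def mult_ac)
  note le = KI_product_le[OF assms(2) this]
  have "KI_product \<beta> \<nu> (\<nu> + 2) x \<le> A * (x * bessel_I (\<nu> + 1) x * bessel_K (\<nu> + 1 + 1) x)"
    using le[of "\<nu> + 2"] by (simp add: add.assoc mult_ac)
  also have "\<dots> < A * 1"
    using assms A by (intro mult_strict_left_mono times_bessel_I_Suc_bessel_K_less_1) auto
  finally show "KI_product \<beta> \<nu> (\<nu> + 2) x < A" by simp
  have "KI_product \<beta> \<nu> (\<nu> + 1) x \<le> A * (x * bessel_I (\<nu> + 1) x * bessel_K (\<nu> + 1) x)"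
    using le[of "\<nu> + 1"] by (simp add: mult_ac)
  also have "\<dots> \<le> A * (1 / 2)"
    using assms A by (intro mult_left_mono less_imp_le[OF times_bessel_I_bessel_K_Suc_less_half]) auto
  finally show "KI_product \<beta> \<nu> (\<nu> + 1) x \<le> A / 2" by simp
qed

text \<open>Here the majorant contains both orders of I, so each product with K is bounded
  separately; the factor \<open>x / (1 + \<delta> * x)\<close> supplies
  \<open>1 / \<delta>\<close>.\<close>

lemma KI_product_bound_le_half:
  assumes "- 1 / 2 < \<nu>" "\<nu> \<le> 1 / 2" "x > 0" "-1 < \<beta>" "\<beta> < 0"
  shows "KI_product \<beta> \<nu> (\<nu> + 2) x \<le> (4 * \<nu> + 6) / ((2 * \<nu> + 1) * (1 + \<beta>))"
    and "KI_product \<beta> \<nu> (\<nu> + 1) x \<le> 3 / ((2 * \<nu> + 1) * (1 + \<beta>))"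
proof -
  define p where "p = 2 * \<nu> + 1"
  define \<delta> where "\<delta> = 1 + \<beta>"
  have pos: "p > 0" "\<delta> > 0" "\<delta> < 1" "x > 0" using assms by (auto simp: p_def \<delta>_def)
  then have d: "1 + \<delta> * x > 0" by (simp add: add_pos_pos)
  let ?i = "bessel_I \<nu> x" and ?j = "bessel_I (\<nu> + 1) x"
  have "2 / (2 * \<nu> + 1) / (1 + (1 + \<beta>) * x) * (x powr (\<nu> + 1) * s) = x powr \<nu> * (2 * x / (p * (1 + \<delta> * x)) * s)" for s
    using pos by (simp add: p_def \<delta>_def powr_add mult_ac)
  then have "bessel_integral \<beta> \<nu> x \<le> exp (\<beta> * x) * (x powr \<nu> * (2 * x / (p * (1 + \<delta> * x)) * (?i + ?j)))"
    using bessel_integral_le_exp'[OF assms] by (simp only:)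
  note le = KI_product_le[OF assms(3) this]
  have scale: "2 * x / (p * (1 + \<delta> * x)) * C \<le> B / (p * \<delta>)" if "2 * (\<delta> * (x * C)) \<le> B * (1 + \<delta> * x)" for B C
    using that pos d by (simp add: divide_le_eq le_divide_eq mult_ac)
  \<comment> \<open>The bound 1 for the term with \<open>?i\<close>, plus 1/2 for the term with
    \<open>?j\<close>.\<close>
  have K1: "x * bessel_K (\<nu> + 1) x * (?i + ?j) \<le> 3 / 2"
    using times_bessel_I_Suc_bessel_K_less_1[OF assms(1,3)]
      times_bessel_I_bessel_K_Suc_less_half[OF assms(1,3)]
    by (simp add: algebra_simps)
  have "KI_product \<beta> \<nu> (\<nu> + 1) x \<le> 2 * x / (p * (1 + \<delta> * x)) * (x * bessel_K (\<nu> + 1) x * (?i + ?j))"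
    using le[of "\<nu> + 1"] by (simp add: mult_ac)
  also have "\<dots> \<le> 2 * x / (p * (1 + \<delta> * x)) * (3 / 2)"
    using pos d K1 by (intro mult_left_mono) auto
  also have "\<dots> \<le> 3 / (p * \<delta>)" by (rule scale) (use pos in simp)
  finally show "KI_product \<beta> \<nu> (\<nu> + 1) x \<le> 3 / ((2 * \<nu> + 1) * (1 + \<beta>))" by (simp add: p_def \<delta>_def)
  have K2: "x * (x * bessel_K (\<nu> + 2) x * (?i + ?j)) \<le> p + 1 + 2 * x"
  proof -
    have "x * ?j * bessel_K (\<nu> + 1 + 1) x \<le> 1"
      using times_bessel_I_Suc_bessel_K_less_1[of "\<nu> + 1" x] assms by simp
    then have 1: "x * ?j * bessel_K (\<nu> + 2) x \<le> 1" by (simp add: add.assoc)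
    \<comment> \<open>Order \<nu> is traded for order \<nu> + 1, because the Wronskian pairs K of
      order \<nu> + 2 with I of order \<nu> + 1.\<close>
    have "x * (?i + ?j) \<le> (p + 1 + 2 * x) * ?j"
      using bessel_I_ratio_lower[of \<nu> x] assms by (simp add: p_def algebra_simps)
    then have "x * bessel_K (\<nu> + 2) x * (x * (?i + ?j)) \<le> x * bessel_K (\<nu> + 2) x * ((p + 1 + 2 * x) * ?j)"
      using pos bessel_K_pos[of x "\<nu> + 2"] by (intro mult_left_mono) auto
    also have "\<dots> = (p + 1 + 2 * x) * (x * ?j * bessel_K (\<nu> + 2) x)" by (simp add: mult_ac)
    also have "\<dots> \<le> (p + 1 + 2 * x) * 1" using pos 1 by (intro mult_left_mono) auto
    finally show ?thesis by (simp add: mult_ac)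
  qed
  have "KI_product \<beta> \<nu> (\<nu> + 2) x \<le> 2 * x / (p * (1 + \<delta> * x)) * (x * bessel_K (\<nu> + 2) x * (?i + ?j))"
    using le[of "\<nu> + 2"] by (simp add: mult_ac)
  also have "\<dots> \<le> (2 * p + 4) / (p * \<delta>)"
  proof (rule scale)
    have "\<delta> * (x * (x * bessel_K (\<nu> + 2) x * (?i + ?j))) \<le> \<delta> * (p + 1 + 2 * x)"
      using K2 pos by (intro mult_left_mono) auto
    also have "\<dots> \<le> (p + 2) * (1 + \<delta> * x)"
    proof -
      have "\<delta> * (p + 1) \<le> 1 * (p + 1)" using pos by (intro mult_right_mono) auto
      moreover have "p * (\<delta> * x) \<ge> 0" using pos by simp
      ultimately show ?thesis by (simp add: algebra_simps)
    qed
    finally show "2 * (\<delta> * (x * (x * bessel_K (\<nu> + 2) x * (?i + ?j)))) \<le> (2 * p + 4) * (1 + \<delta> * x)"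
      by (simp add: algebra_simps)
  qed
  finally show "KI_product \<beta> \<nu> (\<nu> + 2) x \<le> (4 * \<nu> + 6) / ((2 * \<nu> + 1) * (1 + \<beta>))"
    by (simp add: p_def \<delta>_def add.commute)
qed

section \<open>Limits at 0, lower bound at infinity, and suprema\<close>

lemma bessel_K_ratio_le:
  assumes "\<nu> > -1" "x > 0"
  shows "bessel_K (\<nu> + 1) x \<le> x / (2 * \<nu> + 2) * bessel_K (\<nu> + 2) x"
proof -
  have "bessel_K (\<nu> + 2) x = bessel_K \<nu> x + 2 * (\<nu> + 1) / x * bessel_K (\<nu> + 1) x"
    using bessel_K_rec[OF assms(2), of "\<nu> + 1"] by (simp add: add.assoc)
  then have "(2 * \<nu> + 2) / x * bessel_K (\<nu> + 1) x \<le> bessel_K (\<nu> + 2) x"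
    using bessel_K_pos[OF assms(2), of \<nu>] by simp
  then show ?thesis using assms by (simp add: field_simps)
qed

text \<open>A sandwich between the two bounds for the integral near 0, using that
  \<open>x * bessel_I (\<nu> + 1) x * bessel_K (\<nu> + 2) x\<close> lies between
  \<open>1 - x / (2 * \<nu> + 2)\<close> and 1.\<close>

lemma KI_product_add_2_tendsto:
  assumes "\<nu> > - 1 / 2" "\<beta> < 0"
  shows "(KI_product \<beta> \<nu> (\<nu> + 2) \<longlongrightarrow> (2 * \<nu> + 2) / (2 * \<nu> + 1)) (at_right 0)"
proof (rule tendsto_sandwich)
  have nu: "\<nu> > -1" "2 * \<nu> + 1 > 0" "2 * \<nu> + 2 > 0" "2 * \<nu> + 1 \<noteq> 0" using assms by auto
  show "\<forall>\<^sub>F x in at_right 0. (1 + 1 / (2 * \<nu> + 1 + 1 * x)) * (1 - x / (2 * \<nu> + 2)) \<le> KI_product \<beta> \<nu> (\<nu> + 2) x"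
    using eventually_at_right_less
  proof (rule eventually_mono)
    fix x :: real assume x: "x > 0"
    let ?r = "1 + 1 / (2 * \<nu> + 1 + 1 * x)"
    have r: "?r > 0" using nu x by (simp add: add_pos_pos)
    have nu1: "\<nu> + 1 > - 1 / 2" using nu by simp
    note pos = bessel_I_pos[of "\<nu> + 1 + 1" x] bessel_I_pos[of "\<nu> + 1" x] bessel_K_pos[OF x]
    \<comment> \<open>Shows that the second term of the Wronskian at order \<nu> + 1 is only a
      multiple of \<open>x\<close>.\<close>
    have "bessel_I (\<nu> + 1 + 1) x * bessel_K (\<nu> + 1) x \<le> bessel_I (\<nu> + 1) x * (x / (2 * \<nu> + 2) * bessel_K (\<nu> + 2) x)"
      using bessel_I_Suc_less[OF nu1 x] bessel_K_ratio_le[OF nu(1) x] pos x nu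
      by (intro mult_mono) (auto intro: less_imp_le)
    then have "x * (bessel_I (\<nu> + 1 + 1) x * bessel_K (\<nu> + 1) x)
        \<le> x * (bessel_I (\<nu> + 1) x * (x / (2 * \<nu> + 2) * bessel_K (\<nu> + 2) x))"
      using x by (intro mult_left_mono) auto
    also have "\<dots> = x / (2 * \<nu> + 2) * (x * bessel_I (\<nu> + 1) x * bessel_K (\<nu> + 1 + 1) x)"
      by (simp add: add.assoc mult_ac)
    also have "\<dots> \<le> x / (2 * \<nu> + 2) * 1"
      using nu x times_bessel_I_Suc_bessel_K_less_1[OF nu1 x] by (intro mult_left_mono) auto
    finally have "1 - x / (2 * \<nu> + 2) \<le> x * (bessel_I (\<nu> + 1) x * bessel_K (\<nu> + 1 + 1) x)"
      using bessel_wronskian[OF nu1 x] by (simp add: distrib_left)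
    then have "?r * (1 - x / (2 * \<nu> + 2)) \<le> ?r * (x * (bessel_I (\<nu> + 1) x * bessel_K (\<nu> + 1 + 1) x))"
      using r by (intro mult_left_mono) auto
    also have "\<dots> = x * bessel_K (\<nu> + 2) x * (?r * bessel_I (\<nu> + 1) x)"
      by (simp add: add.assoc mult_ac)
    also have "\<dots> \<le> KI_product \<beta> \<nu> (\<nu> + 2) x"
      using bessel_integral_ge_near_0[OF assms(1) x, of \<beta>] assms x
      by (intro KI_product_ge) (simp_all add: mult_ac)
    finally show "?r * (1 - x / (2 * \<nu> + 2)) \<le> KI_product \<beta> \<nu> (\<nu> + 2) x" .
  qed
  show "\<forall>\<^sub>F x in at_right 0. KI_product \<beta> \<nu> (\<nu> + 2) x \<le> exp (- \<beta> * x) * ((2 * \<nu> + 2) / (2 * \<nu> + 1))"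
    using eventually_at_right_less
  proof (rule eventually_mono)
    fix x :: real assume x: "x > 0"
    let ?A = "(2 * \<nu> + 2) / (2 * \<nu> + 1)"
    \<comment> \<open>The factor \<open>exp (- \<beta> * x)\<close> compensates for the missing
      \<open>exp (\<beta> * x)\<close> in the upper bound near 0; it tends to 1.\<close>
    have "KI_product \<beta> \<nu> (\<nu> + 2) x \<le> x * bessel_K (\<nu> + 2) x * (exp (- \<beta> * x) * ?A * bessel_I (\<nu> + 1) x)"
    proof (rule KI_product_le[OF x])
      have "exp (\<beta> * x) * (x powr \<nu> * (exp (- \<beta> * x) * ?A * bessel_I (\<nu> + 1) x))
          = ?A * (x powr \<nu> * bessel_I (\<nu> + 1) x)"
        by (simp add: exp_minus)
      then show "bessel_integral \<beta> \<nu> x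
          \<le> exp (\<beta> * x) * (x powr \<nu> * (exp (- \<beta> * x) * ?A * bessel_I (\<nu> + 1) x))"
        using bessel_integral_le_near_0[OF assms(1) x less_imp_le[OF assms(2)]] by (simp only:)
    qed
    also have "\<dots> = exp (- \<beta> * x) * ?A * (x * bessel_I (\<nu> + 1) x * bessel_K (\<nu> + 1 + 1) x)"
      by (simp add: add.assoc mult_ac)
    also have "\<dots> \<le> exp (- \<beta> * x) * ?A * 1"
      using nu x by (intro mult_left_mono less_imp_le[OF times_bessel_I_Suc_bessel_K_less_1]) auto
    finally show "KI_product \<beta> \<nu> (\<nu> + 2) x \<le> exp (- \<beta> * x) * ?A" by simp
  qed
  note r = reciprocal_affine_tendsto[OF nu(4), of 1]
  have lim: "((\<lambda>x. x / (2 * \<nu> + 2)) \<longlongrightarrow> 0) (at_right 0)"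
    using nu by (auto intro!: tendsto_eq_intros)
  have "((\<lambda>x. (1 + 1 / (2 * \<nu> + 1 + 1 * x)) * (1 - x / (2 * \<nu> + 2))) \<longlongrightarrow> (1 + 1 / (2 * \<nu> + 1)) * (1 - 0)) (at_right 0)"
    by (intro tendsto_intros r lim)
  then show "((\<lambda>x. (1 + 1 / (2 * \<nu> + 1 + 1 * x)) * (1 - x / (2 * \<nu> + 2))) \<longlongrightarrow> (2 * \<nu> + 2) / (2 * \<nu> + 1)) (at_right 0)"
    using nu by (simp add: field_simps)
  have "((\<lambda>x. exp (- \<beta> * x) * ((2 * \<nu> + 2) / (2 * \<nu> + 1))) \<longlongrightarrow> exp (- \<beta> * 0) * ((2 * \<nu> + 2) / (2 * \<nu> + 1))) (at_right 0)"
    by (intro tendsto_intros)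
  then show "((\<lambda>x. exp (- \<beta> * x) * ((2 * \<nu> + 2) / (2 * \<nu> + 1))) \<longlongrightarrow> (2 * \<nu> + 2) / (2 * \<nu> + 1)) (at_right 0)"
    by simp
qed

lemma KI_product_le_Suc:
  assumes "\<nu> > - 1 / 2" "x > 0" "\<mu> \<ge> - 1 / 2"
  shows "KI_product \<beta> \<nu> \<mu> x \<le> KI_product \<beta> \<nu> (\<mu> + 1) x"
  using KI_product_mono[OF assms(1,2), of \<mu> 1 "\<mu> + 1"] bessel_K_le[OF assms(2), of \<mu> "\<mu> + 1"] assms(3) by simp

lemma KI_product_tendsto_0:
  assumes "\<nu> > - 1 / 2" "\<beta> < 0"
  shows "(KI_product \<beta> \<nu> (\<nu> + 1) \<longlongrightarrow> 0) (at_right 0)" "(KI_product \<beta> \<nu> \<nu> \<longlongrightarrow> 0) (at_right 0)"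
proof -
  have nu: "\<nu> > -1" using assms by simp
  have "((\<lambda>x. x / (2 * \<nu> + 2)) \<longlongrightarrow> 0) (at_right 0)"
    using nu by (auto intro!: tendsto_eq_intros)
  from tendsto_mult[OF this KI_product_add_2_tendsto[OF assms]]
  have lim: "((\<lambda>x. x / (2 * \<nu> + 2) * KI_product \<beta> \<nu> (\<nu> + 2) x) \<longlongrightarrow> 0) (at_right 0)" by simp
  show 1: "(KI_product \<beta> \<nu> (\<nu> + 1) \<longlongrightarrow> 0) (at_right 0)"
  proof (rule tendsto_sandwich[OF _ _ tendsto_const lim])
    show "\<forall>\<^sub>F x in at_right 0. 0 \<le> KI_product \<beta> \<nu> (\<nu> + 1) x"
      using eventually_at_right_less by (rule eventually_mono) (rule KI_product_nonneg[OF assms(1)])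
    show "\<forall>\<^sub>F x in at_right 0. KI_product \<beta> \<nu> (\<nu> + 1) x \<le> x / (2 * \<nu> + 2) * KI_product \<beta> \<nu> (\<nu> + 2) x"
      using eventually_at_right_less
      by (rule eventually_mono) (intro KI_product_mono bessel_K_ratio_le nu assms)
  qed
  show "(KI_product \<beta> \<nu> \<nu> \<longlongrightarrow> 0) (at_right 0)"
  proof (rule tendsto_sandwich[OF _ _ tendsto_const 1])
    show "\<forall>\<^sub>F x in at_right 0. 0 \<le> KI_product \<beta> \<nu> \<nu> x"
      using eventually_at_right_less by (rule eventually_mono) (rule KI_product_nonneg[OF assms(1)])
    show "\<forall>\<^sub>F x in at_right 0. KI_product \<beta> \<nu> \<nu> x \<le> KI_product \<beta> \<nu> (\<nu> + 1) x"
      using eventually_at_right_less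
      by (rule eventually_mono) (use assms in \<open>auto intro: KI_product_le_Suc\<close>)
  qed
qed

text \<open>A rational minorant whose limit at infinity is \<open>1 / (2 * (1 + \<beta>))\<close>:
  neighbouring orders of I and of K differ by factors tending to 1, so the Wronskian forces
  \<open>x * j * k\<close> to be at least about 1/2.\<close>

lemma KI_product_lower:
  assumes "\<nu> > - 1 / 2" "x > 0" "-1 < \<beta>" "\<beta> < 0"
  shows "x / (2 * \<nu> + 2 + (1 + \<beta>) * x) / (1 + (1 + (2 * \<nu> + 1) / x) * (1 + (2 * \<nu> + 2) / x)) \<le> KI_product \<beta> \<nu> \<nu> x"
proof -
  have nu: "\<nu> > -1" using assms by simp
  define i j k l where "i = bessel_I \<nu> x" "j = bessel_I (\<nu> + 1) x" "k = bessel_K \<nu> x" "l = bessel_K (\<nu> + 1) x"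
  note defs = i_j_k_l_def
  have pos: "i > 0" "j > 0" "k > 0" "l > 0"
    using assms by (auto simp: defs intro: bessel_I_pos bessel_K_pos)
  let ?s = "1 + (2 * \<nu> + 1) / x" and ?t = "1 + (2 * \<nu> + 2) / x"
  have "(2 * \<nu> + 1) / x > 0" "(2 * \<nu> + 2) / x > 0" using assms by simp_all
  then have st: "?s > 0" "?t > 0" by (simp_all add: add_pos_pos)
  have i: "i \<le> ?t * j" using bessel_I_ratio_lower[OF nu assms(2)] assms(2) by (simp add: defs field_simps)
  have l: "l \<le> ?s * k"
  proof -
    \<comment> \<open>Enlarging \<open>l\<close> to \<open>l + k\<close> on the right lets the
      factor \<open>l + k\<close> cancel.\<close>
    have "x * (l - k) * (l + k) < (2 * \<nu> + 1) * k * l"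
      using bessel_K_turan[OF assms(1,2)] by (simp add: defs power2_eq_square algebra_simps)
    also have "\<dots> \<le> (2 * \<nu> + 1) * k * (l + k)" using assms pos by (intro mult_left_mono) auto
    finally have "x * (l - k) < (2 * \<nu> + 1) * k" using pos by (simp add: mult_less_cancel_right)
    then show ?thesis using assms(2) by (simp add: field_simps)
  qed
  have "1 = x * (i * l + j * k)" using bessel_wronskian[OF assms(1,2)] by (simp add: defs)
  also have "\<dots> \<le> x * (?t * j * (?s * k) + j * k)"
    using assms(2) pos i l st by (intro mult_left_mono add_right_mono mult_mono) auto
  also have "x * (t * j * (s * k) + j * k) = x * j * k * (1 + s * t)" for s t by algebra
  finally have le: "1 / (1 + ?s * ?t) \<le> x * j * k"
    using st by (simp add: pos_divide_le_eq add_pos_pos)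
  define d where "d = 2 * \<nu> + 2 + (1 + \<beta>) * x"
  have "(1 + \<beta>) * x > 0" using assms by simp
  then have d: "d > 0" unfolding d_def using nu by simp
  have "x / d / (1 + ?s * ?t) = x / d * (1 / (1 + ?s * ?t))" by simp
  also have "\<dots> \<le> x / d * (x * j * k)" using le assms(2) d by (intro mult_left_mono) auto
  also have "\<dots> = x * bessel_K \<nu> x * (x / d * j)" by (simp add: defs mult_ac)
  also have "\<dots> \<le> KI_product \<beta> \<nu> \<nu> x"
    using bessel_integral_ge_at_top[OF assms] assms(2)
    by (intro KI_product_ge) (simp_all add: defs d_def powr_add mult_ac)
  finally show ?thesis by (simp add: d_def)
qed

text \<open>The rational minorant \<open>?g\<close> approaches the claimed value at infinity. In
  \<open>ereal\<close> the supremum exists without a prior bound.\<close>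

lemma SUP_KI_product_ge:
  assumes "\<nu> > - 1 / 2" "-1 < \<beta>" "\<beta> < 0" and le: "\<And>x. x > 0 \<Longrightarrow> KI_product \<beta> \<nu> \<nu> x \<le> KI_product \<beta> \<nu> \<mu> x"
  shows "ereal (1 / (2 * (1 + \<beta>))) \<le> (SUP x\<in>{0..}. ereal (KI_product \<beta> \<nu> \<mu> x))"
proof -
  let ?g = "\<lambda>x. x / (2 * \<nu> + 2 + (1 + \<beta>) * x) / (1 + (1 + (2 * \<nu> + 1) / x) * (1 + (2 * \<nu> + 2) / x))"
  have pos: "1 + \<beta> > 0" using assms by simp
  have "1 / (2 * (1 + \<beta>)) = inverse (1 + \<beta>) / 2" using pos by (simp add: field_simps)
  moreover have "(?g \<longlongrightarrow> inverse (1 + \<beta>) / 2) at_top" using pos by real_asymp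
  ultimately have "(?g \<longlongrightarrow> 1 / (2 * (1 + \<beta>))) at_top" by (simp only:)
  then have "((\<lambda>x. ereal (?g x)) \<longlongrightarrow> ereal (1 / (2 * (1 + \<beta>)))) at_top" by (rule tendsto_ereal)
  then show ?thesis
  proof (rule tendsto_upperbound)
    show "\<forall>\<^sub>F x in at_top. ereal (?g x) \<le> (SUP x\<in>{0..}. ereal (KI_product \<beta> \<nu> \<mu> x))"
      using eventually_gt_at_top[of 0]
    proof (rule eventually_mono)
      fix x :: real assume x: "0 < x"
      have "ereal (?g x) \<le> ereal (KI_product \<beta> \<nu> \<mu> x)"
        using order_trans[OF KI_product_lower[OF assms(1) x assms(2,3)] le[OF x]] by simp
      also have "\<dots> \<le> (SUP x\<in>{0..}. ereal (KI_product \<beta> \<nu> \<mu> x))" using x by (intro SUP_upper) auto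
      finally show "ereal (?g x) \<le> (SUP x\<in>{0..}. ereal (KI_product \<beta> \<nu> \<mu> x))" .
    qed
  qed simp
qed

text \<open>The value at 0 is the limit of the values at positive \<open>x\<close> and inherits
  their bound.\<close>

lemma SUP_KI_product_le:
  assumes "\<And>x. x > 0 \<Longrightarrow> KI_product \<beta> \<nu> \<mu> x \<le> B" and "(KI_product \<beta> \<nu> \<mu> \<longlongrightarrow> L) (at_right 0)"
  shows "(SUP x\<in>{0..}. ereal (KI_product \<beta> \<nu> \<mu> x)) \<le> ereal B"
proof (rule SUP_least)
  have "L \<le> B"
    by (rule tendsto_upperbound[OF assms(2) eventually_mono[OF eventually_at_right_less]])
      (use assms(1) in auto)
  then show "ereal (KI_product \<beta> \<nu> \<mu> x) \<le> ereal B" if "x \<in> {0..}" for x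
    using that assms(1)[of x] KI_product_0[OF assms(2)] by (cases "x = 0") auto
qed

theorem theorem3p2:
  fixes \<beta> :: real
  assumes "- 1 < \<beta>" and "\<beta> < 0"
  shows "(\<forall>\<nu>::real. \<nu> \<ge> 1 / 2 \<longrightarrow>
           (\<forall>x\<ge>0. KI_product \<beta> \<nu> (\<nu> + 2) x < 2 * (\<nu> + 1) / ((2 * \<nu> + 1) * (1 + \<beta>)))) \<and>
         (\<forall>\<nu>::real. \<nu> > - 1 / 2 \<longrightarrow>
           ereal (max (1 / (2 * (1 + \<beta>))) (2 * (\<nu> + 1) / (2 * \<nu> + 1)))
             \<le> (SUP x\<in>{0..}. ereal (KI_product \<beta> \<nu> (\<nu> + 2) x)) \<and>
           (SUP x\<in>{0..}. ereal (KI_product \<beta> \<nu> (\<nu> + 2) x))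
             < ereal ((2 * \<nu> + 7) / ((2 * \<nu> + 1) * (1 + \<beta>))) \<and>
           ereal (1 / (2 * (1 + \<beta>)))
             \<le> (SUP x\<in>{0..}. ereal (KI_product \<beta> \<nu> (\<nu> + 1) x)) \<and>
           (SUP x\<in>{0..}. ereal (KI_product \<beta> \<nu> (\<nu> + 1) x))
             < ereal ((2 * \<nu> + 7) / (2 * (2 * \<nu> + 1) * (1 + \<beta>))) \<and>
           ereal (1 / (2 * (1 + \<beta>)))
             \<le> (SUP x\<in>{0..}. ereal (KI_product \<beta> \<nu> \<nu> x)) \<and>
           (SUP x\<in>{0..}. ereal (KI_product \<beta> \<nu> \<nu> x))
             < ereal ((2 * \<nu> + 7) / (2 * (2 * \<nu> + 1) * (1 + \<beta>))))"
proof (intro conjI allI impI)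
  fix \<nu> x :: real assume nu: "\<nu> \<ge> 1 / 2" and "x \<ge> 0"
  show "KI_product \<beta> \<nu> (\<nu> + 2) x < 2 * (\<nu> + 1) / ((2 * \<nu> + 1) * (1 + \<beta>))"
  proof (cases "x = 0")
    case True
    \<comment> \<open>At 0 the value is the limit, and strictness comes from
      \<open>1 / (1 + \<beta>) > 1\<close>.\<close>
    have "(2 * \<nu> + 2) / (2 * \<nu> + 1) * 1 < (2 * \<nu> + 2) / (2 * \<nu> + 1) * (1 / (1 + \<beta>))"
      using nu assms by (intro mult_strict_left_mono) auto
    moreover have "KI_product \<beta> \<nu> (\<nu> + 2) 0 = (2 * \<nu> + 2) / (2 * \<nu> + 1)"
      using nu assms by (intro KI_product_0 KI_product_add_2_tendsto) auto
    ultimately show ?thesis using True by (simp add: distrib_left)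
  next
    case False
    then show ?thesis
      using KI_product_bound_ge_half(1)[OF nu _ assms, of x] \<open>x \<ge> 0\<close> by (simp add: distrib_left)
  qed
next
  fix \<nu> :: real assume nu: "\<nu> > - 1 / 2"
  define P where "P = (2 * \<nu> + 1) * (1 + \<beta>)"
  have P: "P > 0" using nu assms by (simp add: P_def)
  note lim2 = KI_product_add_2_tendsto[OF nu assms(2)]
    and lim = KI_product_tendsto_0[OF nu assms(2)]
  have le: "KI_product \<beta> \<nu> \<nu> x \<le> KI_product \<beta> \<nu> (\<nu> + 1) x"
    "KI_product \<beta> \<nu> (\<nu> + 1) x \<le> KI_product \<beta> \<nu> (\<nu> + 2) x" if "x > 0" for x
    using KI_product_le_Suc[OF nu that, of \<nu> \<beta>] KI_product_le_Suc[OF nu that, of "\<nu> + 1" \<beta>] nu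
    by (auto simp: add.assoc)
  show lower: "ereal (1 / (2 * (1 + \<beta>))) \<le> (SUP x\<in>{0..}. ereal (KI_product \<beta> \<nu> (\<nu> + 1) x))"
    "ereal (1 / (2 * (1 + \<beta>))) \<le> (SUP x\<in>{0..}. ereal (KI_product \<beta> \<nu> \<nu> x))"
    by (intro SUP_KI_product_ge nu assms le order_refl; assumption)+
  have "ereal (1 / (2 * (1 + \<beta>))) \<le> (SUP x\<in>{0..}. ereal (KI_product \<beta> \<nu> (\<nu> + 2) x))"
    using le by (intro SUP_KI_product_ge nu assms) (meson order_trans)
  \<comment> \<open>The limit at 0 is itself one of the values over which the supremum runs.\<close>
  moreover have "ereal (2 * (\<nu> + 1) / (2 * \<nu> + 1)) \<le> (SUP x\<in>{0..}. ereal (KI_product \<beta> \<nu> (\<nu> + 2) x))"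
    using KI_product_0[OF lim2] by (intro SUP_upper2[of 0]) (auto simp: distrib_left)
  ultimately show "ereal (max (1 / (2 * (1 + \<beta>))) (2 * (\<nu> + 1) / (2 * \<nu> + 1)))
      \<le> (SUP x\<in>{0..}. ereal (KI_product \<beta> \<nu> (\<nu> + 2) x))"
    by (simp add: max_def)
  \<comment> \<open>Constants strictly below \<open>2 * \<nu> + 7\<close>, which keep the inequality
    strict after taking suprema: \<open>2 * \<nu> + 2\<close> for \<nu> \<ge> 1/2; otherwise
    \<open>4 * \<nu> + 6\<close>, where \<nu> < 1/2 is used, and 6, where \<nu> > -1/2 is
    used.\<close>
  obtain B2 B1 where B: "B2 < 2 * \<nu> + 7" "B1 < 2 * \<nu> + 7"
    and bound: "\<And>x. x > 0 \<Longrightarrow> KI_product \<beta> \<nu> (\<nu> + 2) x \<le> B2 / P"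
      "\<And>x. x > 0 \<Longrightarrow> KI_product \<beta> \<nu> (\<nu> + 1) x \<le> B1 / (2 * P)"
  proof (cases "\<nu> \<ge> 1 / 2")
    case True
    show ?thesis
      using KI_product_bound_ge_half[OF True _ assms] nu
      by (intro that[of "2 * \<nu> + 2" "2 * \<nu> + 2"]) (auto simp: P_def mult_ac intro: less_imp_le)
  next
    case False
    then show ?thesis
      using KI_product_bound_le_half[OF nu _ _ assms] nu
      by (intro that[of "4 * \<nu> + 6" 6]) (auto simp: P_def mult.commute)
  qed
  have "(SUP x\<in>{0..}. ereal (KI_product \<beta> \<nu> (\<nu> + 2) x)) \<le> ereal (B2 / P)"
    by (rule SUP_KI_product_le[OF bound(1) lim2])
  also have "\<dots> < ereal ((2 * \<nu> + 7) / P)" using B P by (simp add: divide_strict_right_mono)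
  finally show "(SUP x\<in>{0..}. ereal (KI_product \<beta> \<nu> (\<nu> + 2) x)) < ereal ((2 * \<nu> + 7) / ((2 * \<nu> + 1) * (1 + \<beta>)))"
    by (simp add: P_def)
  have less: "ereal (B1 / (2 * P)) < ereal ((2 * \<nu> + 7) / (2 * (2 * \<nu> + 1) * (1 + \<beta>)))"
  proof -
    have "2 * (2 * \<nu> + 1) * (1 + \<beta>) = 2 * P" by (simp add: P_def)
    then show ?thesis using B P by (simp only: ereal_less) (simp add: divide_strict_right_mono)
  qed
  have "(SUP x\<in>{0..}. ereal (KI_product \<beta> \<nu> (\<nu> + 1) x)) \<le> ereal (B1 / (2 * P))"
    by (rule SUP_KI_product_le[OF bound(2) lim(1)])
  then show "(SUP x\<in>{0..}. ereal (KI_product \<beta> \<nu> (\<nu> + 1) x)) < ereal ((2 * \<nu> + 7) / (2 * (2 * \<nu> + 1) * (1 + \<beta>)))"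
    using less by (rule le_less_trans)
  have "(SUP x\<in>{0..}. ereal (KI_product \<beta> \<nu> \<nu> x)) \<le> ereal (B1 / (2 * P))"
    by (rule SUP_KI_product_le[OF _ lim(2)]) (use bound(2) le(1) in \<open>meson order_trans\<close>)
  then show "(SUP x\<in>{0..}. ereal (KI_product \<beta> \<nu> \<nu> x)) < ereal ((2 * \<nu> + 7) / (2 * (2 * \<nu> + 1) * (1 + \<beta>)))"
    using less by (rule le_less_trans)
qed

end
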